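(* Let $G$ be a simple connected graph on $n\geq 2$ vertices $1,2,\ldots,n$ with signless Laplacian matrix $Q$, and let $i\in\{1,2,\ldots,n\}$. Then $$\det(Q(i))=\sum_{H}4^{c(H)},$$ where the summation runs over all $TU$-subgraphs $H$ of $G$ with exactly $n-1$ edges consisting of a unique tree component, which contains the vertex $i$, and $c(H)$ odd-unicyclic components.
   Context: Graphs are finite and simple. The signless Laplacian matrix of $G$ is $Q=D+A$, where $D$ is the diagonal matrix of vertex degrees and $A$ is the $0/1$ adjacency matrix. $Q(i)$ denotes the submatrix of $Q$ obtained by deleting row $i$ and column $i$. A unicyclic graph is a connected graph containing exactly one cycle; it is odd-unicyclic if that cycle has odd length. A tree may consist of a single vertex. A $TU$-graph is a graph each of whose connected components is a tree or an odd-unicyclic graph. A $TU$-subgraph of $G$ is a spanning subgraph of $G$ (i.e. having all vertices of $G$) that is a $TU$-graph. For a $TU$-subgraph $H$, $c(H)\ge 0$ denotes the number of connected components of $H$ that are odd-unicyclic. *)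

theory Defs
  imports "Jordan_Normal_Form.Determinant"
begin

section \<open>Finite simple graphs\<close>

text \<open>The library theories on digraphs do not provide undirected cycles and trees: in a symmetric
  digraph every edge already yields a directed cycle of length two.  Undirected graphs are
  therefore represented by a vertex set and a set of two-element sets of vertices.\<close>

record 'a ugraph =
  verts :: "'a set"
  edges :: "'a set set"

definition simple_graph :: "'a ugraph \<Rightarrow> bool" where
  "simple_graph G \<longleftrightarrow> finite (verts G) \<and>
     (\<forall>e \<in> edges G. \<exists>u \<in> verts G. \<exists>v \<in> verts G. u \<noteq> v \<and> e = {u, v})"

definition subgraph :: "'a ugraph \<Rightarrow> 'a ugraph \<Rightarrow> bool" where
  "subgraph H G \<longleftrightarrow> simple_graph H \<and> verts H \<subseteq> verts G \<and> edges H \<subseteq> edges G"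

definition spanning_subgraph :: "'a ugraph \<Rightarrow> 'a ugraph \<Rightarrow> bool" where
  "spanning_subgraph H G \<longleftrightarrow> subgraph H G \<and> verts H = verts G"

definition induced_subgraph :: "'a ugraph \<Rightarrow> 'a set \<Rightarrow> 'a ugraph" where
  "induced_subgraph G S = \<lparr>verts = S, edges = {e \<in> edges G. e \<subseteq> S}\<rparr>"

definition vertex_degree :: "'a ugraph \<Rightarrow> 'a \<Rightarrow> nat" where
  "vertex_degree G v = card {e \<in> edges G. v \<in> e}"

definition reachable :: "'a ugraph \<Rightarrow> 'a \<Rightarrow> 'a \<Rightarrow> bool" where
  "reachable G u v \<longleftrightarrow> (u, v) \<in> {(x, y). {x, y} \<in> edges G}\<^sup>*"

definition connected_graph :: "'a ugraph \<Rightarrow> bool" where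
  "connected_graph G \<longleftrightarrow> verts G \<noteq> {} \<and> (\<forall>u \<in> verts G. \<forall>v \<in> verts G. reachable G u v)"

definition components :: "'a ugraph \<Rightarrow> 'a ugraph set" where
  "components G = (\<lambda>u. induced_subgraph G {v \<in> verts G. reachable G u v}) ` verts G"


section \<open>Trees and odd-unicyclic graphs\<close>

text \<open>A cycle is a graph, not a closed walk, so that different starting points and orientations
  do not give different cycles.\<close>

definition cycle_graph :: "'a ugraph \<Rightarrow> bool" where
  "cycle_graph C \<longleftrightarrow> (\<exists>xs. distinct xs \<and> 3 \<le> length xs \<and> verts C = set xs \<and>
     edges C = {{xs ! k, xs ! (Suc k mod length xs)} | k. k < length xs})"

definition cycles :: "'a ugraph \<Rightarrow> 'a ugraph set" where
  "cycles G = {C. cycle_graph C \<and> subgraph C G}"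

definition tree :: "'a ugraph \<Rightarrow> bool" where
  "tree G \<longleftrightarrow> connected_graph G \<and> cycles G = {}"

definition unicyclic :: "'a ugraph \<Rightarrow> bool" where
  "unicyclic G \<longleftrightarrow> connected_graph G \<and> (\<exists>!C. C \<in> cycles G)"

definition odd_unicyclic :: "'a ugraph \<Rightarrow> bool" where
  "odd_unicyclic G \<longleftrightarrow> unicyclic G \<and> (\<forall>C \<in> cycles G. odd (card (edges C)))"

definition TU_graph :: "'a ugraph \<Rightarrow> bool" where
  "TU_graph G \<longleftrightarrow> simple_graph G \<and> (\<forall>C \<in> components G. tree C \<or> odd_unicyclic C)"

definition TU_subgraph :: "'a ugraph \<Rightarrow> 'a ugraph \<Rightarrow> bool" where
  "TU_subgraph H G \<longleftrightarrow> spanning_subgraph H G \<and> TU_graph H"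

definition num_odd_unicyclic :: "'a ugraph \<Rightarrow> nat" where
  "num_odd_unicyclic H = card {C \<in> components H. odd_unicyclic C}"


section \<open>The signless Laplacian\<close>

text \<open>Matrix indices start at 0, so the matrices below belong to graphs with
  vertex set \<open>{0..<n}\<close>.\<close>

definition degree_matrix :: "nat \<Rightarrow> nat ugraph \<Rightarrow> real mat" where
  "degree_matrix n G = mat n n (\<lambda>(u, v). if u = v then real (vertex_degree G u) else 0)"

definition adjacency_matrix :: "nat \<Rightarrow> nat ugraph \<Rightarrow> real mat" where
  "adjacency_matrix n G = mat n n (\<lambda>(u, v). if {u, v} \<in> edges G then 1 else 0)"

definition signless_laplacian :: "nat \<Rightarrow> nat ugraph \<Rightarrow> real mat" where
  "signless_laplacian n G = degree_matrix n G + adjacency_matrix n G"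

end

theory Submission
  imports Defs "HOL-Combinatorics.Cycles"
begin

text \<open>
  Let $U$ be the vertex set without $i$. Since $Q = N N^T$ for the unsigned vertex-edge incidence
  matrix $N$, the Cauchy-Binet formula writes $\det Q(i)$ as the sum of $(\det N_{U,S})^2$ over the
  sets $S$ of $n-1$ edges, and it remains to see that this square is $4^c$ when $S$ spans a graph of
  the required kind, with $c$ odd-unicyclic components, and $0$ otherwise.

  Both halves are done directly with signed sums over permutations, so that arbitrary finite index
  sets $U$ and $S$ can be used. Expanding every row $u$ of $Q(i)$ over the edges at $u$ turns the
  minor into a sum over functions $f$ that choose at every $u \in U$ an incident edge; if $f$ is not
  injective its contribution has two equal rows and vanishes, and the injective ones are grouped by
  their image $S$ (\<open>leibniz_sum_eq_sum_incidence_weight\<close>). The group of $S$ is the number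
  \<open>incidence_weight U S\<close>, which equals $(\det N_{U,S})^2$.

  The value of this weight is found by induction on the number of vertices
  (\<open>incidence_weight_eq\<close>). A vertex other than $i$ without edges makes the weight vanish, and its
  component is a tree that misses $i$. A vertex other than $i$ of degree one can be deleted together
  with its edge: this changes neither the weight nor the cycles. In the remaining case all vertices
  other than $i$ have degree at least two; as there are only $n-1$ edges, counting degrees shows that
  $i$ is isolated and all other degrees are exactly two. Then any cycle is a whole component, and it
  splits off as a factor of the weight. The two orientations of a cycle are its only edge_choices of
  edges, each with determinant $1 + 1$ or $1 - 1$ according to the parity of its length
  (\<open>incidence_weight_cycle\<close>), which gives the factor $4$ or $0$. Both reductions use that the
  weight is multiplicative for block triangular incidence matrices (\<open>incidence_weight_Un\<close>).

  The condition that is carried through the induction speaks only about reachability and cycles: from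
  every vertex of the component of $i$ no cycle can be reached, from any other vertex exactly one
  cycle, of odd length. Translating it back into components (\<open>rooted_TU_iff\<close>) and counting
  odd-unicyclic components by their cycles (\<open>num_odd_unicyclic_eq\<close>) gives the theorem.
\<close>

section \<open>Signed edge_choices of incident edges\<close>

definition edge_choices :: "'a set \<Rightarrow> 'a set set \<Rightarrow> ('a \<Rightarrow> 'a set) set" where
  "edge_choices U S = {f \<in> U \<rightarrow>\<^sub>E S. bij_betw f U S \<and> (\<forall>u\<in>U. u \<in> f u)}"

text \<open>The permutations $p$ that contribute to the Leibniz expansion of the square $0/1$ matrix
  whose row $u$ is the incidence vector of the edge $f(u)$; \<open>choice_det\<close> is the determinant of that
  matrix.\<close>
definition perms_along :: "'a set \<Rightarrow> ('a \<Rightarrow> 'a set) \<Rightarrow> ('a \<Rightarrow> 'a) set" where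
  "perms_along U f = {p. p permutes U \<and> (\<forall>u\<in>U. p u \<in> f u)}"

definition choice_det :: "'a set \<Rightarrow> ('a \<Rightarrow> 'a set) \<Rightarrow> int" where
  "choice_det U f = (\<Sum>p\<in>perms_along U f. sign p)"

text \<open>This is $(\det N_{U,S})^2$ for the incidence matrix $N$: one factor is expanded over the
  bijections $f$ from $U$ to $S$, and $f$ composed with the inverse of $p$ is the bijection that
  belongs to the other factor.\<close>
definition incidence_weight :: "'a set \<Rightarrow> 'a set set \<Rightarrow> int" where
  "incidence_weight U S = (\<Sum>f\<in>edge_choices U S. choice_det U f)"

lemma choice_det_cong:
  assumes "\<And>u. u \<in> U \<Longrightarrow> f u = g u"
  shows "choice_det U f = choice_det U g"
  using assms by (simp add: choice_det_def perms_along_def cong: conj_cong)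

text \<open>A matrix with two equal rows has determinant zero: composing with the transposition of the two
  row indices reverses the sign.\<close>
lemma choice_det_not_inj:
  assumes fin: "finite U" and "\<not> inj_on f U"
  shows "choice_det U f = 0"
proof -
  obtain a b where ab: "a \<in> U" "b \<in> U" "a \<noteq> b" "f a = f b"
    using assms by (auto simp: inj_on_def)
  let ?t = "Transposition.transpose a b"
  have t: "?t permutes U" using ab by (simp add: permutes_swap_id)
  have step: "p \<circ> ?t \<in> perms_along U f" if "p \<in> perms_along U f" for p
  proof -
    have "p permutes U" "\<forall>u\<in>U. p u \<in> f u" using that by (auto simp: perms_along_def)
    then show ?thesis using ab permutes_compose[OF t]
      by (auto simp: perms_along_def Transposition.transpose_def)
  qed
  have "choice_det U f = (\<Sum>p\<in>perms_along U f. sign (p \<circ> ?t))"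
    unfolding choice_det_def
    by (rule sum.reindex_bij_witness[where i = "\<lambda>p. p \<circ> ?t" and j = "\<lambda>p. p \<circ> ?t"])
       (use step in \<open>auto simp: comp_assoc transpose_comp_involutory\<close>)
  also have "\<dots> = (\<Sum>p\<in>perms_along U f. - sign p)"
  proof (rule sum.cong[OF refl])
    fix p assume "p \<in> perms_along U f"
    then have "permutation p" using fin by (auto simp: perms_along_def permutation_permutes)
    then show "sign (p \<circ> ?t) = - sign p"
      using ab by (simp add: sign_compose permutation_swap_id sign_swap_id)
  qed
  also have "\<dots> = - choice_det U f" by (simp add: choice_det_def sum_negf)
  finally show ?thesis by simp
qed

text \<open>The Cauchy-Binet formula for the Gram matrix whose entry at $u, v$ is the number of edges
  through both $u$ and $v$. It comes from multiplying out the rows as sums over edges.\<close>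
lemma leibniz_sum_eq_sum_incidence_weight:
  assumes fin: "finite U" and finE: "finite E"
  shows "(\<Sum>p | p permutes U. sign p * (\<Prod>u\<in>U. int (card {e\<in>E. u \<in> e \<and> p u \<in> e})))
       = (\<Sum>S | S \<subseteq> E \<and> card S = card U. incidence_weight U S)"
proof -
  let ?F = "{f \<in> U \<rightarrow>\<^sub>E E. \<forall>u\<in>U. u \<in> f u}"
  let ?I = "{f \<in> ?F. inj_on f U}"
  have finF: "finite (U \<rightarrow>\<^sub>E E)" using fin finE by (simp add: finite_PiE)
  have finP: "finite {p. p permutes U}" using fin by (rule finite_permutations)
  have "(\<Sum>p | p permutes U. sign p * (\<Prod>u\<in>U. int (card {e\<in>E. u \<in> e \<and> p u \<in> e})))
    = (\<Sum>p | p permutes U. \<Sum>f\<in>U \<rightarrow>\<^sub>E E.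
         (if \<forall>u\<in>U. u \<in> f u \<and> p u \<in> f u then sign p else 0))"
  proof (rule sum.cong[OF refl])
    fix p :: "'a \<Rightarrow> 'a"
    have "(\<Prod>u\<in>U. int (card {e\<in>E. u \<in> e \<and> p u \<in> e}))
      = (\<Prod>u\<in>U. \<Sum>e\<in>E. if u \<in> e \<and> p u \<in> e then 1 else 0)"
      using finE by (intro prod.cong refl) (simp add: sum.If_cases Int_def)
    also have "\<dots> = (\<Sum>f\<in>U \<rightarrow>\<^sub>E E. \<Prod>u\<in>U. if u \<in> f u \<and> p u \<in> f u then 1 else 0)"
      using fin finE by (subst prod_sum_PiE) auto
    also have "\<dots> = (\<Sum>f\<in>U \<rightarrow>\<^sub>E E. if \<forall>u\<in>U. u \<in> f u \<and> p u \<in> f u then 1 else 0)"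
      using fin by (intro sum.cong refl) (auto intro!: prod.neutral simp: prod_zero_iff)
    finally show "sign p * (\<Prod>u\<in>U. int (card {e\<in>E. u \<in> e \<and> p u \<in> e}))
      = (\<Sum>f\<in>U \<rightarrow>\<^sub>E E. (if \<forall>u\<in>U. u \<in> f u \<and> p u \<in> f u then sign p else 0))"
      by (simp add: sum_distrib_left if_distrib cong: if_cong)
  qed
  also have "\<dots> = (\<Sum>f\<in>U \<rightarrow>\<^sub>E E. \<Sum>p | p permutes U.
         (if \<forall>u\<in>U. u \<in> f u \<and> p u \<in> f u then sign p else 0))"
    by (rule sum.swap)
  also have "\<dots> = (\<Sum>f\<in>U \<rightarrow>\<^sub>E E. if \<forall>u\<in>U. u \<in> f u then choice_det U f else 0)"
    using finP
    by (intro sum.cong refl)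
       (auto simp: choice_det_def perms_along_def sum.inter_filter[symmetric] intro!: sum.cong sum.neutral)
  also have "\<dots> = (\<Sum>f\<in>?F. choice_det U f)"
    using finF by (simp add: sum.inter_filter[symmetric])
  also have "\<dots> = (\<Sum>f\<in>?I. choice_det U f)"
    using finF choice_det_not_inj[OF fin] by (intro sum.mono_neutral_right) auto
  also have "\<dots> = (\<Sum>S | S \<subseteq> E \<and> card S = card U. \<Sum>f | f \<in> ?I \<and> f ` U = S. choice_det U f)"
    using finF finE by (intro sum.group[symmetric]) (auto simp: card_image)
  also have "\<dots> = (\<Sum>S | S \<subseteq> E \<and> card S = card U. incidence_weight U S)"
    unfolding incidence_weight_def edge_choices_def
    by (intro sum.cong refl) (auto simp: bij_betw_def PiE_def Pi_def)
  finally show ?thesis .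
qed

text \<open>The matrix of $f$ is block triangular: the edges chosen in $U_2$ avoid $U_1$, so a contributing
  permutation preserves $U_2$ and therefore also $U_1$.\<close>
lemma choice_det_Un:
  assumes fin: "finite U1" "finite U2" and disj: "U1 \<inter> U2 = {}"
    and miss: "\<And>u. u \<in> U2 \<Longrightarrow> f u \<inter> U1 = {}"
  shows "choice_det (U1 \<union> U2) f = choice_det U1 f * choice_det U2 f"
proof -
  \<comment> \<open>A permutation preserving both parts is the product of its restrictions, extended by the identity.\<close>
  let ?cut = "\<lambda>A p x. if x \<in> A then p x else (x::'a)"
  have split: "p ` U1 = U1 \<and> p ` U2 = U2" if p: "p \<in> perms_along (U1 \<union> U2) f" for p
  proof -
    have pp: "p permutes (U1 \<union> U2)" and pf: "\<forall>u\<in>U1 \<union> U2. p u \<in> f u"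
      using p by (auto simp: perms_along_def)
    have "p ` U2 \<subseteq> U2" using pf miss permutes_in_image[OF pp] by blast
    then have 2: "p ` U2 = U2"
      using fin(2) permutes_inj_on[OF pp] by (intro endo_inj_surj) auto
    have "p ` U1 = p ` (U1 \<union> U2) - p ` U2"
      using disj permutes_inj[OF pp] by (auto simp: inj_def)
    then show ?thesis using 2 permutes_image[OF pp] disj by auto
  qed
  have cut: "?cut A p permutes A" if "p ` A = A" "p permutes (U1 \<union> U2)" for A p
  proof (rule bij_imp_permutes)
    have "bij_betw p A A" using that permutes_inj_on[OF that(2)] by (simp add: bij_betw_def)
    then show "bij_betw (?cut A p) A A" by (rule bij_betw_cong[THEN iffD1, rotated]) simp
  qed simp
  have "choice_det U1 f * choice_det U2 f
    = (\<Sum>(p, q)\<in>perms_along U1 f \<times> perms_along U2 f. sign p * sign q)"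
    by (simp add: choice_det_def sum_product sum.cartesian_product)
  also have "\<dots> = (\<Sum>p\<in>perms_along (U1 \<union> U2) f. sign p)"
  proof (rule sum.reindex_bij_witness[where j = "\<lambda>(p, q). p \<circ> q" and i = "\<lambda>p. (?cut U1 p, ?cut U2 p)"])
    fix pq assume "pq \<in> perms_along U1 f \<times> perms_along U2 f"
    then obtain p q where pq: "pq = (p, q)" and p: "p permutes U1" "\<forall>u\<in>U1. p u \<in> f u"
      and q: "q permutes U2" "\<forall>u\<in>U2. q u \<in> f u" by (auto simp: perms_along_def)
    have q1: "q x = x" if "x \<in> U1" for x using that disj q(1) by (auto simp: permutes_def)
    have p2: "p x = x" if "x \<notin> U1" for x using that p(1) by (auto simp: permutes_def)
    have q2: "q x = x" if "x \<notin> U2" for x using that q(1) by (auto simp: permutes_def)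
    have qm: "q x \<in> U2" if "x \<in> U2" for x using that permutes_in_image[OF q(1)] by blast
    have pq2: "p (q x) = q x" if "x \<in> U2" for x using that qm disj p2 by blast
    have "?cut U1 (p \<circ> q) = p" by (auto simp: fun_eq_iff q1 p2)
    moreover have "?cut U2 (p \<circ> q) = q" by (auto simp: fun_eq_iff q2 pq2)
    ultimately show "(case case pq of (p, q) \<Rightarrow> p \<circ> q of p \<Rightarrow> (?cut U1 p, ?cut U2 p)) = pq"
      by (simp only: pq prod.case)
    have "p \<circ> q permutes (U1 \<union> U2)"
      using p(1) q(1) by (intro permutes_compose) (auto elim: permutes_subset)
    then show "(case pq of (p, q) \<Rightarrow> p \<circ> q) \<in> perms_along (U1 \<union> U2) f"
      using p(2) q(2) by (auto simp: pq perms_along_def q1 pq2)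
    show "sign (case pq of (p, q) \<Rightarrow> p \<circ> q) = (case pq of (p, q) \<Rightarrow> sign p * sign q)"
      using p(1) q(1) fin by (simp add: pq) (metis sign_compose permutation_permutes)
  next
    fix p assume p: "p \<in> perms_along (U1 \<union> U2) f"
    then have pp: "p permutes (U1 \<union> U2)" by (simp add: perms_along_def)
    have "p x = x" if "x \<notin> U1" "x \<notin> U2" for x using that pp by (auto simp: permutes_def)
    moreover have "p x \<notin> U1" if "x \<in> U2" for x using split[OF p] that disj by auto
    ultimately show "(case (?cut U1 p, ?cut U2 p) of (p, q) \<Rightarrow> p \<circ> q) = p"
      using disj by (auto simp: fun_eq_iff)
    show "(?cut U1 p, ?cut U2 p) \<in> perms_along U1 f \<times> perms_along U2 f"
      using p split[OF p] cut[OF _ pp] by (auto simp: perms_along_def)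
  qed
  finally show ?thesis by (simp add: choice_det_def)
qed

text \<open>Only the edges in $S_1$ meet $U_1$, and there are just enough of them, so they are used up
  by $U_1$.\<close>
lemma edge_choices_split:
  assumes fin: "finite U1" "finite S1" and card: "card U1 = card S1"
    and disjU: "U1 \<inter> U2 = {}" and disjS: "S1 \<inter> S2 = {}"
    and miss: "\<And>e. e \<in> S2 \<Longrightarrow> e \<inter> U1 = {}"
    and f: "f \<in> edge_choices (U1 \<union> U2) (S1 \<union> S2)"
  shows "f ` U1 = S1" "f ` U2 = S2"
proof -
  have bij: "bij_betw f (U1 \<union> U2) (S1 \<union> S2)" and mem: "\<forall>u\<in>U1 \<union> U2. u \<in> f u"
    using f by (auto simp: edge_choices_def)
  have inj: "inj_on f (U1 \<union> U2)" and im: "f ` (U1 \<union> U2) = S1 \<union> S2"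
    using bij by (auto simp: bij_betw_def)
  have "f ` U1 \<subseteq> S1" using im mem miss by blast
  moreover have "card (f ` U1) = card S1"
    using card inj by (metis card_image inj_on_Un)
  ultimately show 1: "f ` U1 = S1" using fin by (simp add: card_subset_eq)
  have "f ` U1 \<inter> f ` U2 = {}"
    using inj disjU by (auto simp: inj_on_def)
  moreover have "S1 \<union> f ` U2 = S1 \<union> S2" using im unfolding image_Un 1 .
  ultimately show "f ` U2 = S2" using disjS unfolding 1 by blast
qed

text \<open>The edges in $S_1$ may meet $U_2$: this is what allows a leaf with its edge to be split
  off from a graph to which it is attached.\<close>
lemma incidence_weight_Un:
  assumes fin: "finite U1" "finite U2" "finite S1" and card: "card U1 = card S1"
    and disjU: "U1 \<inter> U2 = {}" and disjS: "S1 \<inter> S2 = {}"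
    and miss: "\<And>e. e \<in> S2 \<Longrightarrow> e \<inter> U1 = {}"
  shows "incidence_weight (U1 \<union> U2) (S1 \<union> S2) = incidence_weight U1 S1 * incidence_weight U2 S2"
proof -
  \<comment> \<open>Restriction to the two parts, and gluing, identify choices for the union with pairs of choices.\<close>
  let ?glue = "\<lambda>(f, g) x. if x \<in> U1 then f x else (g x :: 'a set)"
  have "incidence_weight U1 S1 * incidence_weight U2 S2
    = (\<Sum>(f, g)\<in>edge_choices U1 S1 \<times> edge_choices U2 S2. choice_det U1 f * choice_det U2 g)"
    by (simp add: incidence_weight_def sum_product sum.cartesian_product)
  also have "\<dots> = (\<Sum>f\<in>edge_choices (U1 \<union> U2) (S1 \<union> S2). choice_det (U1 \<union> U2) f)"
  proof (rule sum.reindex_bij_witness[where j = ?glue and i = "\<lambda>f. (restrict f U1, restrict f U2)"])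
    fix fg assume "fg \<in> edge_choices U1 S1 \<times> edge_choices U2 S2"
    then obtain f g where fg: "fg = (f, g)" and f: "f \<in> edge_choices U1 S1" and g: "g \<in> edge_choices U2 S2"
      by auto
    have ext: "f x = undefined" if "x \<notin> U1" for x using f that by (auto simp: edge_choices_def)
    have ext': "g x = undefined" if "x \<notin> U2" for x using g that by (auto simp: edge_choices_def)
    show "(restrict (?glue fg) U1, restrict (?glue fg) U2) = fg"
      using disjU ext ext' by (auto simp: fg fun_eq_iff)
    have gS: "g u \<in> S2" if "u \<in> U2" for u using g that by (auto simp: edge_choices_def)
    have glue1: "?glue fg x = f x" if "x \<in> U1" for x using that by (simp add: fg)
    have glue2: "?glue fg x = g x" if "x \<in> U2" for x using that disjU by (auto simp: fg)
    have "bij_betw (?glue fg) U1 S1"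
      using f glue1 by (auto simp: edge_choices_def cong: bij_betw_cong)
    moreover have "bij_betw (?glue fg) U2 S2"
      using g glue2 by (auto simp: edge_choices_def cong: bij_betw_cong)
    ultimately have "bij_betw (?glue fg) (U1 \<union> U2) (S1 \<union> S2)"
      using disjS by (rule bij_betw_combine)
    moreover have "?glue fg x = undefined" if "x \<notin> U1 \<union> U2" for x
      using that ext' by (simp add: fg)
    moreover have "\<forall>u\<in>U1 \<union> U2. u \<in> ?glue fg u"
      using f g glue1 glue2 by (auto simp: edge_choices_def)
    ultimately show "?glue fg \<in> edge_choices (U1 \<union> U2) (S1 \<union> S2)"
      by (auto simp: edge_choices_def PiE_def extensional_def bij_betw_def)
    have "choice_det (U1 \<union> U2) (?glue fg) = choice_det U1 (?glue fg) * choice_det U2 (?glue fg)"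
      using fin disjU glue2 gS miss by (intro choice_det_Un) auto
    then show "choice_det (U1 \<union> U2) (?glue fg) = (case fg of (f, g) \<Rightarrow> choice_det U1 f * choice_det U2 g)"
      using choice_det_cong[of U1, OF glue1] choice_det_cong[of U2, OF glue2] by (simp add: fg)
  next
    fix f assume f: "f \<in> edge_choices (U1 \<union> U2) (S1 \<union> S2)"
    note im = edge_choices_split[OF fin(1,3) card disjU disjS miss f]
    have inj: "inj_on f (U1 \<union> U2)" using f by (auto simp: edge_choices_def bij_betw_def)
    then have injs: "inj_on f U1" "inj_on f U2" by (auto simp: inj_on_Un)
    have ext: "f x = undefined" if "x \<notin> U1 \<union> U2" for x using f that by (auto simp: edge_choices_def)
    show "?glue (restrict f U1, restrict f U2) = f" using ext by (auto simp: fun_eq_iff)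
    show "(restrict f U1, restrict f U2) \<in> edge_choices U1 S1 \<times> edge_choices U2 S2"
      using f im injs by (auto simp: edge_choices_def bij_betw_def inj_on_def)
  qed
  finally show ?thesis by (simp add: incidence_weight_def)
qed

lemma incidence_weight_singleton:
  assumes "u \<in> e"
  shows "incidence_weight {u} {e} = 1"
proof -
  have "edge_choices {u} {e} = {\<lambda>x\<in>{u}. e}"
    using assms by (auto simp: edge_choices_def bij_betw_def PiE_def extensional_def fun_eq_iff)
  moreover have "perms_along {u} (\<lambda>x\<in>{u}. e) = {id}"
    using assms by (auto simp: perms_along_def permutes_sing)
  ultimately show ?thesis by (simp add: incidence_weight_def choice_det_def)
qed

lemma incidence_weight_empty: "incidence_weight ({} :: 'a set) {} = 1"
proof -
  have "edge_choices ({} :: 'a set) {} = {\<lambda>x. undefined}"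
    by (auto simp: edge_choices_def bij_betw_def)
  moreover have "perms_along ({} :: 'a set) (\<lambda>x. undefined) = {id}"
    by (auto simp: perms_along_def)
  ultimately show ?thesis by (simp add: incidence_weight_def choice_det_def)
qed

lemma incidence_weight_isolated:
  assumes "u \<in> U" and "\<And>e. e \<in> S \<Longrightarrow> u \<notin> e"
  shows "incidence_weight U S = 0"
proof -
  have "edge_choices U S = {}" using assms by (fastforce simp: edge_choices_def)
  then show ?thesis by (simp add: incidence_weight_def)
qed

section \<open>The weight of a cycle\<close>

text \<open>A permutation that runs through all of $X$ in a single cycle of length at least three. The
  single cycle is expressed by the absence of proper nonempty invariant subsets, which is the
  form in which it is used: a property that propagates along $s$ holds everywhere or nowhere.\<close>
definition rotation :: "('a \<Rightarrow> 'a) \<Rightarrow> 'a set \<Rightarrow> bool" where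
  "rotation s X \<longleftrightarrow> finite X \<and> X \<noteq> {} \<and> s permutes X \<and> (\<forall>x\<in>X. s x \<noteq> x \<and> s (s x) \<noteq> x) \<and>
     (\<forall>A\<subseteq>X. A \<noteq> {} \<longrightarrow> s ` A \<subseteq> A \<longrightarrow> A = X)"

lemma rotationD:
  assumes "rotation s X"
  shows "finite X" "X \<noteq> {}" "s permutes X" "x \<in> X \<Longrightarrow> s x \<in> X" "x \<in> X \<Longrightarrow> s x \<noteq> x"
    "x \<in> X \<Longrightarrow> s (s x) \<noteq> x"
  using assms by (auto simp: rotation_def permutes_in_image)

lemma rotation_closed:
  assumes "rotation s X" "a \<in> X" "P a" "\<And>x. x \<in> X \<Longrightarrow> P x \<Longrightarrow> P (s x)" "x \<in> X"
  shows "P x"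
proof -
  have closed: "\<forall>A\<subseteq>X. A \<noteq> {} \<longrightarrow> s ` A \<subseteq> A \<longrightarrow> A = X"
    using assms(1) by (simp add: rotation_def)
  have "{x \<in> X. P x} = X"
    by (rule closed[rule_format]) (use assms(2-4) rotationD(4)[OF assms(1)] in auto)
  then show ?thesis using assms(5) by blast
qed

lemma rotation_inv:
  assumes "rotation s X"
  shows "rotation (Hilbert_Choice.inv s) X"
proof -
  note s = rotationD[OF assms]
  have inv_in: "Hilbert_Choice.inv s x \<in> X" if "x \<in> X" for x
    using that permutes_in_image[OF permutes_inv[OF s(3)]] by blast
  have si: "s (Hilbert_Choice.inv s x) = x" "Hilbert_Choice.inv s (s x) = x" for x
    using permutes_inverses[OF s(3)] by auto
  have "A = X" if A: "A \<subseteq> X" "A \<noteq> {}" "Hilbert_Choice.inv s ` A \<subseteq> A" for A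
  proof -
    have "Hilbert_Choice.inv s ` A = A"
      using finite_subset[OF A(1) s(1)] A(3) permutes_inj_on[OF permutes_inv[OF s(3)]]
      by (rule endo_inj_surj)
    then have "s ` Hilbert_Choice.inv s ` A = s ` A" by simp
    then have "s ` A \<subseteq> A" by (simp add: image_image si)
    then show ?thesis using assms A by (auto simp: rotation_def)
  qed
  moreover have "Hilbert_Choice.inv s x \<noteq> x \<and> Hilbert_Choice.inv s (Hilbert_Choice.inv s x) \<noteq> x" if "x \<in> X" for x
    using s(5)[OF inv_in[OF that]] s(6)[OF inv_in[OF inv_in[OF that]]] by (simp add: si)
  ultimately show ?thesis
    using s(1,2) permutes_inv[OF s(3)] by (auto simp: rotation_def)
qed

text \<open>A contributing permutation fixes each vertex or moves it to its successor. If one vertex moves,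
  its successor cannot stay and moves on as well, so everything moves or nothing does.\<close>
lemma choice_det_rotation:
  assumes "rotation s X" and f: "\<And>x. x \<in> X \<Longrightarrow> f x = {x, s x}"
  shows "choice_det X f = 1 + sign s"
proof -
  note s = rotationD[OF assms(1)]
  have "perms_along X f = {id, s}"
  proof (rule equalityI; rule subsetI)
    fix p assume "p \<in> perms_along X f"
    then have p: "p permutes X" "\<And>x. x \<in> X \<Longrightarrow> p x = x \<or> p x = s x"
      using f by (auto simp: perms_along_def)
    have step: "p (s x) = s (s x)" if "x \<in> X" "p x = s x" for x
      using p(2)[of "s x"] that s(4,5) permutes_inj[OF p(1)] by (metis inj_eq)
    show "p \<in> {id, s}"
    proof (cases "\<exists>a\<in>X. p a = s a")
      case True
      then have "p x = s x" if "x \<in> X" for x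
        using rotation_closed[OF assms(1), where P = "\<lambda>x. p x = s x"] step that by blast
      moreover have "p x = s x" if "x \<notin> X" for x
        using that p(1) s(3) by (simp add: permutes_not_in)
      ultimately show ?thesis by (auto simp: fun_eq_iff)
    next
      case False
      then have "p x = x" for x using p by (cases "x \<in> X") (auto simp: permutes_not_in)
      then show ?thesis by (auto simp: fun_eq_iff)
    qed
  next
    fix p assume "p \<in> {id, s}"
    then show "p \<in> perms_along X f"
      using f s(3) by (auto simp: perms_along_def permutes_id)
  qed
  moreover have "s \<noteq> id" using s(2,5) by auto
  ultimately show ?thesis by (simp add: choice_det_def)
qed

lemma rotation_inj_edges:
  assumes "rotation s X"
  shows "inj_on (\<lambda>x. {x, s x}) X"
  unfolding inj_on_def doubleton_eq_iff using rotationD(6)[OF assms] by metis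

text \<open>A choice of distinct incident edges orients the cycle: if one vertex takes its outgoing edge,
  the next one has to do the same. So there are two choices, one for each orientation, and the
  inverse rotation has the same sign.\<close>
lemma incidence_weight_rotation:
  assumes "rotation s X"
  shows "incidence_weight X ((\<lambda>x. {x, s x}) ` X) = 2 * (1 + sign s)"
proof -
  note s = rotationD[OF assms]
  note s' = rotationD[OF rotation_inv[OF assms]]
  have si: "s (Hilbert_Choice.inv s x) = x" "Hilbert_Choice.inv s (s x) = x" for x
    using permutes_inverses[OF s(3)] by auto
  \<comment> \<open>The two orientations of the cycle.\<close>
  define f where "f = (\<lambda>x\<in>X. {x, s x})"
  define g where "g = (\<lambda>x\<in>X. {x, Hilbert_Choice.inv s x})"
  note injf = rotation_inj_edges[OF assms]
  have "edge_choices X ((\<lambda>x. {x, s x}) ` X) = {f, g}"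
  proof (rule equalityI; rule subsetI)
    fix h assume "h \<in> edge_choices X ((\<lambda>x. {x, s x}) ` X)"
    then have h: "bij_betw h X ((\<lambda>x. {x, s x}) ` X)" "\<And>x. x \<in> X \<Longrightarrow> x \<in> h x"
      and ext: "\<And>x. x \<notin> X \<Longrightarrow> h x = undefined"
      by (auto simp: edge_choices_def)
    have or: "h x = {x, s x} \<or> h x = {x, Hilbert_Choice.inv s x}" if x: "x \<in> X" for x
    proof -
      have "h x \<in> (\<lambda>x. {x, s x}) ` X" using bij_betwE[OF h(1)] x by blast
      then obtain y where "y \<in> X" "h x = {y, s y}" by blast
      moreover have "x = y \<or> x = s y" using calculation h(2)[OF x] by auto
      ultimately show ?thesis using si by auto
    qed
    have step: "h (s x) = {s x, s (s x)}" if x: "x \<in> X" "h x = {x, s x}" for x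
    proof -
      have "h (s x) \<noteq> h x"
        using h(1) x s(4,5) by (metis bij_betw_def inj_onD)
      then show ?thesis using or[OF s(4)[OF x(1)]] x by (auto simp: si)
    qed
    show "h \<in> {f, g}"
    proof (cases "\<exists>a\<in>X. h a = {a, s a}")
      case True
      then have "h x = {x, s x}" if "x \<in> X" for x
        using rotation_closed[OF assms, where P = "\<lambda>x. h x = {x, s x}"] step that by blast
      then have "h = f" using ext by (auto simp: f_def fun_eq_iff)
      then show ?thesis by simp
    next
      case False
      then have "h = g" using ext or by (auto simp: g_def fun_eq_iff)
      then show ?thesis by simp
    qed
  next
    have "bij_betw f X ((\<lambda>x. {x, s x}) ` X)"
      using injf by (auto simp: f_def bij_betw_def inj_on_def)
    then have 1: "f \<in> edge_choices X ((\<lambda>x. {x, s x}) ` X)"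
      by (auto simp: edge_choices_def f_def)
    have "bij_betw ((\<lambda>x. {x, s x}) \<circ> Hilbert_Choice.inv s) X ((\<lambda>x. {x, s x}) ` X)"
      using injf by (intro bij_betw_trans[OF permutes_imp_bij[OF s'(3)]]) (simp add: bij_betw_def)
    then have "bij_betw g X ((\<lambda>x. {x, s x}) ` X)"
      by (rule bij_betw_cong[THEN iffD1, rotated]) (auto simp: g_def si)
    then have 2: "g \<in> edge_choices X ((\<lambda>x. {x, s x}) ` X)"
      by (auto simp: edge_choices_def g_def bij_betw_def)
    fix h assume "h \<in> {f, g}"
    then show "h \<in> edge_choices X ((\<lambda>x. {x, s x}) ` X)" using 1 2 by auto
  qed
  moreover have "f \<noteq> g"
  proof
    assume "f = g"
    obtain x where x: "x \<in> X" using s(2) by blast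
    have "{x, s x} = {x, Hilbert_Choice.inv s x}"
      using fun_cong[OF \<open>f = g\<close>, of x] x by (simp only: f_def g_def restrict_apply')
    then have "s x = Hilbert_Choice.inv s x" by (auto simp: doubleton_eq_iff)
    then show False using s(6)[OF x] si by metis
  qed
  moreover have "choice_det X f = 1 + sign s"
    using assms by (rule choice_det_rotation) (simp add: f_def)
  moreover have "choice_det X g = 1 + sign (Hilbert_Choice.inv s)"
    using rotation_inv[OF assms] by (rule choice_det_rotation) (simp add: g_def)
  moreover have "sign (Hilbert_Choice.inv s) = sign s"
    using s(1,3) by (intro sign_inverse) (auto simp: permutation_permutes)
  ultimately show ?thesis by (simp add: incidence_weight_def)
qed

lemma sign_cycle_of_list: "distinct xs \<Longrightarrow> sign (cycle_of_list xs) = (-1) ^ (length xs - 1)"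
  by (induction xs rule: cycle_of_list.induct)
     (simp_all add: sign_compose permutation_swap_id permutation_of_cycle sign_swap_id)

text \<open>Replaces the list of vertices of a cycle, with its index arithmetic modulo the length, by
  the successor function.\<close>
lemma cycle_graph_rotation:
  assumes "cycle_graph C"
  obtains s where "rotation s (verts C)" "edges C = (\<lambda>x. {x, s x}) ` verts C"
    "sign s = (-1) ^ (card (verts C) - 1)"
proof -
  obtain xs where xs: "distinct xs" "3 \<le> length xs" "verts C = set xs"
    and E: "edges C = {{xs ! k, xs ! (Suc k mod length xs)} | k. k < length xs}"
    using assms by (auto simp: cycle_graph_def)
  let ?s = "cycle_of_list xs"
  let ?n = "length xs"
  have "map ?s xs = rotate1 xs" using cyclic_rotation[OF xs(1), of 1] by simp
  then have nth: "?s (xs ! k) = xs ! (Suc k mod ?n)" if "k < ?n" for k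
    using that by (metis nth_map nth_rotate1)
  have lt: "m mod ?n < ?n" for m using xs(2) by (intro mod_less_divisor) linarith
  have "?s x \<noteq> x \<and> ?s (?s x) \<noteq> x" if x: "x \<in> set xs" for x
  proof -
    obtain k where k: "k < ?n" "x = xs ! k" using x by (auto simp: in_set_conv_nth)
    have "Suc k mod ?n \<noteq> k" using k(1) xs(2) by (auto simp: mod_Suc)
    moreover have "Suc (Suc k mod ?n) mod ?n \<noteq> k" using k(1) xs(2) by (auto simp: mod_Suc)
    ultimately show ?thesis using k lt by (simp add: nth nth_eq_iff_index_eq[OF xs(1)])
  qed
  moreover have "A = set xs" if A: "A \<subseteq> set xs" "A \<noteq> {}" "?s ` A \<subseteq> A" for A
  proof -
    obtain a where a: "a \<in> A" using A(2) by blast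
    then have "a \<in> set xs" using A(1) by blast
    then obtain k where k: "k < ?n" "xs ! k \<in> A" using a by (metis in_set_conv_nth)
    have *: "xs ! ((k + j) mod ?n) \<in> A" for j
    proof (induction j)
      case (Suc j)
      have "?s (xs ! ((k + j) mod ?n)) \<in> A" using Suc A(3) by blast
      then show ?case using lt[of "k + j"] by (simp add: nth mod_Suc_eq)
    qed (use k in simp)
    have "xs ! m \<in> A" if "m < ?n" for m
      using *[of "m + ?n - k"] that k(1) by simp
    then show ?thesis using A(1) by (auto simp: in_set_conv_nth)
  qed
  ultimately have "rotation ?s (verts C)"
    using xs cycle_permutes[of xs] by (auto simp: rotation_def)
  moreover have "edges C = (\<lambda>x. {x, ?s x}) ` verts C"
  proof -
    have "edges C = (\<lambda>k. {xs ! k, ?s (xs ! k)}) ` {..<?n}"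
      unfolding E using nth by auto
    also have "\<dots> = (\<lambda>x. {x, ?s x}) ` (!) xs ` {..<?n}" by (simp add: image_image)
    also have "(!) xs ` {..<?n} = verts C" unfolding xs(3) set_conv_nth by auto
    finally show ?thesis .
  qed
  moreover have "sign ?s = (-1) ^ (card (verts C) - 1)"
    using sign_cycle_of_list[OF xs(1)] xs by (simp add: distinct_card)
  ultimately show ?thesis by (rule that)
qed

lemma incidence_weight_cycle:
  assumes "cycle_graph C"
  shows "incidence_weight (verts C) (edges C) = (if odd (card (verts C)) then 4 else 0)"
proof -
  obtain s where s: "rotation s (verts C)" "edges C = (\<lambda>x. {x, s x}) ` verts C"
    "sign s = (-1) ^ (card (verts C) - 1)" using assms by (rule cycle_graph_rotation)
  have "card (verts C) > 0" using rotationD(1,2)[OF s(1)] by (simp add: card_gt_0_iff)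
  then show ?thesis using incidence_weight_rotation[OF s(1)] s(2,3) by (auto simp: even_Suc)
qed

section \<open>Reachability and cycles\<close>

lemma reachable_refl [simp]: "reachable G u u"
  by (simp add: reachable_def)

lemma reachable_trans: "reachable G u v \<Longrightarrow> reachable G v w \<Longrightarrow> reachable G u w"
  unfolding reachable_def by (rule rtrancl_trans)

lemma reachable_sym: "reachable G u v \<Longrightarrow> reachable G v u"
proof -
  have "sym {(x, y). {x, y} \<in> edges G}" by (auto simp: sym_def insert_commute)
  then show "reachable G u v \<Longrightarrow> reachable G v u"
    unfolding reachable_def by (metis sym_rtrancl symD)
qed

lemma reachable_edge: "{u, v} \<in> edges G \<Longrightarrow> reachable G u v"
  by (auto simp: reachable_def)

lemma reachable_step: "reachable G a u \<Longrightarrow> {u, v} \<in> edges G \<Longrightarrow> reachable G a v"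
  by (rule reachable_trans[OF _ reachable_edge])

lemma reachable_induct [consumes 1, case_names refl step]:
  assumes "reachable G a b" and "P a"
    and "\<And>x y. reachable G a x \<Longrightarrow> {x, y} \<in> edges G \<Longrightarrow> P x \<Longrightarrow> P y"
  shows "P b"
  using assms unfolding reachable_def by (induction rule: rtrancl_induct) auto

lemma reachable_mono: "reachable G u v \<Longrightarrow> edges G \<subseteq> edges H \<Longrightarrow> reachable H u v"
  by (induction rule: reachable_induct) (auto intro: reachable_step)

lemma simple_graphD:
  assumes "simple_graph G" "e \<in> edges G"
  shows "e \<subseteq> verts G" "card e = 2" "u \<in> e \<Longrightarrow> \<exists>v. v \<noteq> u \<and> e = {u, v}"
proof -
  obtain a b where "a \<in> verts G" "b \<in> verts G" "a \<noteq> b" "e = {a, b}"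
    using assms unfolding simple_graph_def by meson
  then show "e \<subseteq> verts G" "card e = 2" "u \<in> e \<Longrightarrow> \<exists>v. v \<noteq> u \<and> e = {u, v}" by auto
qed

lemma finite_edges: "simple_graph G \<Longrightarrow> finite (edges G)"
  by (rule finite_subset[of _ "Pow (verts G)"]) (auto dest: simple_graphD(1) simp: simple_graph_def)

lemma simple_cycle_graph: "cycle_graph C \<Longrightarrow> simple_graph C"
proof (erule cycle_graph_rotation)
  fix s assume s: "rotation s (verts C)" "edges C = (\<lambda>x. {x, s x}) ` verts C"
  have "\<exists>u\<in>verts C. \<exists>v\<in>verts C. u \<noteq> v \<and> {x, s x} = {u, v}" if "x \<in> verts C" for x
    by (rule bexI[OF bexI[OF _ rotationD(4)[OF s(1) that]] that])
       (use rotationD(5)[OF s(1) that] in simp)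
  then show "simple_graph C" using rotationD(1)[OF s(1)] s(2) by (auto simp: simple_graph_def)
qed

lemma cyclesD:
  assumes "C \<in> cycles G"
  shows "cycle_graph C" "verts C \<subseteq> verts G" "edges C \<subseteq> edges G" "simple_graph C"
    "finite (verts C)" "verts C \<noteq> {}"
proof -
  show "cycle_graph C" "verts C \<subseteq> verts G" "edges C \<subseteq> edges G"
    using assms by (auto simp: cycles_def subgraph_def)
  then show "simple_graph C" by (simp add: simple_cycle_graph)
  show "finite (verts C)" "verts C \<noteq> {}"
    using \<open>cycle_graph C\<close> by (metis cycle_graph_rotation rotationD(1,2))+
qed

lemma cyclesI: "cycle_graph C \<Longrightarrow> verts C \<subseteq> verts G \<Longrightarrow> edges C \<subseteq> edges G \<Longrightarrow> C \<in> cycles G"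
  by (simp add: cycles_def subgraph_def simple_cycle_graph)

lemma card_edges_cycle: "cycle_graph C \<Longrightarrow> card (edges C) = card (verts C)"
  by (erule cycle_graph_rotation) (simp add: card_image rotation_inj_edges)

lemma cycle_vertex_degree:
  assumes "cycle_graph C" "x \<in> verts C"
  shows "card {e \<in> edges C. x \<in> e} = 2"
proof -
  obtain s where s: "rotation s (verts C)" "edges C = (\<lambda>x. {x, s x}) ` verts C"
    using assms(1) by (rule cycle_graph_rotation)
  note r = rotationD[OF s(1)]
  have si: "s (Hilbert_Choice.inv s y) = y" "Hilbert_Choice.inv s (s y) = y" for y
    using permutes_inverses[OF r(3)] by auto
  have inv_in: "Hilbert_Choice.inv s x \<in> verts C" using rotationD(4)[OF rotation_inv[OF s(1)]] assms(2) .
  have "{x, Hilbert_Choice.inv s x} = {Hilbert_Choice.inv s x, s (Hilbert_Choice.inv s x)}" using si by auto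
  then have "{x, Hilbert_Choice.inv s x} \<in> edges C" using inv_in s(2) by blast
  moreover have "e = {x, s x} \<or> e = {x, Hilbert_Choice.inv s x}" if "e \<in> edges C" "x \<in> e" for e
    using that s(2) si by auto
  ultimately have "{e \<in> edges C. x \<in> e} = {{x, s x}, {x, Hilbert_Choice.inv s x}}"
    using assms(2) s(2) by auto
  moreover have "s x \<noteq> Hilbert_Choice.inv s x" using r(6)[OF assms(2)] si by metis
  ultimately show ?thesis using r(5)[OF assms(2)] by (simp add: card_insert_if doubleton_eq_iff)
qed

text \<open>Induction along the edges of a cycle.\<close>
lemma cycle_closed:
  assumes "cycle_graph C" "a \<in> verts C" "P a"
    and "\<And>x y. {x, y} \<in> edges C \<Longrightarrow> P x \<Longrightarrow> P y"
    and "x \<in> verts C"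
  shows "P x"
proof -
  obtain s where s: "rotation s (verts C)" "edges C = (\<lambda>x. {x, s x}) ` verts C"
    using assms(1) by (rule cycle_graph_rotation)
  show ?thesis
    by (rule rotation_closed[where P = P, OF s(1) assms(2,3) _ assms(5)])
       (use s(2) assms(4) in blast)
qed

lemma cycle_reachable:
  assumes C: "C \<in> cycles G" and "x \<in> verts C" "y \<in> verts C"
  shows "reachable G x y"
  by (rule cycle_closed[OF cyclesD(1)[OF C] assms(2) _ _ assms(3)])
     (use cyclesD(3)[OF C] in \<open>auto intro: reachable_step\<close>)

text \<open>For a vertex of a simple graph these are the cycles of its component, described without
  forming the component.\<close>
definition cycles_near :: "'a ugraph \<Rightarrow> 'a \<Rightarrow> 'a ugraph set" where
  "cycles_near G u = {C \<in> cycles G. \<exists>x\<in>verts C. reachable G u x}"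

text \<open>What the component of a single vertex $u$ of a simple graph has to look like: a tree if it contains $i$, and
  odd-unicyclic otherwise.\<close>
definition rooted_TU_at :: "'a ugraph \<Rightarrow> 'a \<Rightarrow> 'a \<Rightarrow> bool" where
  "rooted_TU_at G i u \<longleftrightarrow> (if reachable G u i then cycles_near G u = {}
     else \<exists>C. cycles_near G u = {C} \<and> odd (card (edges C)))"

definition rooted_TU :: "'a ugraph \<Rightarrow> 'a \<Rightarrow> bool" where
  "rooted_TU G i \<longleftrightarrow> (\<forall>u\<in>verts G. rooted_TU_at G i u)"

lemma reachable_cong: "reachable G u v \<Longrightarrow> reachable G u x = reachable G v x"
  using reachable_trans reachable_sym by metis

lemma cycles_near_cong: "reachable G u v \<Longrightarrow> cycles_near G u = cycles_near G v"
  using reachable_cong[of G u v] unfolding cycles_near_def by blast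

text \<open>An isolated vertex is a tree component without $i$.\<close>
lemma isolated_not_rooted_TU:
  assumes "u \<in> verts G" "u \<noteq> i" and iso: "\<And>e. e \<in> edges G \<Longrightarrow> u \<notin> e"
  shows "\<not> rooted_TU G i"
proof -
  have only: "b = u" if "reachable G u b" for b
    using that by (induction rule: reachable_induct) (use iso in auto)
  have "C \<notin> cycles_near G u" for C
  proof
    assume "C \<in> cycles_near G u"
    then have C: "C \<in> cycles G" "u \<in> verts C" using only by (auto simp: cycles_near_def)
    then have "card {e \<in> edges C. u \<in> e} = 2"
      using cycle_vertex_degree[OF cyclesD(1)[OF C(1)] C(2)] by simp
    moreover have "{e \<in> edges C. u \<in> e} = {}" using iso cyclesD(3)[OF C(1)] by auto
    ultimately show False by simp
  qed
  moreover have "\<not> reachable G u i" using only assms(2) by blast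
  ultimately have "\<not> rooted_TU_at G i u" unfolding rooted_TU_at_def by auto
  then show ?thesis using assms(1) unfolding rooted_TU_def by blast
qed

text \<open>The end of a longest path has a second neighbour, which must lie on the path and
  closes a cycle.\<close>
lemma cycle_exists:
  assumes G: "simple_graph G" and "edges G \<noteq> {}"
    and deg: "\<And>x e. e \<in> edges G \<Longrightarrow> x \<in> e \<Longrightarrow> \<exists>e'\<in>edges G. x \<in> e' \<and> e' \<noteq> e"
  shows "cycles G \<noteq> {}"
proof -
  define path where "path xs \<longleftrightarrow> distinct xs \<and> set xs \<subseteq> verts G \<and> 2 \<le> length xs \<and>
    (\<forall>k. Suc k < length xs \<longrightarrow> {xs ! k, xs ! Suc k} \<in> edges G)" for xs
  obtain e0 where e0: "e0 \<in> edges G" using assms(2) by blast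
  then obtain a b where ab: "a \<in> verts G" "b \<in> verts G" "a \<noteq> b" "e0 = {a, b}"
    using G unfolding simple_graph_def by meson
  have "path [a, b]" using ab e0 by (simp add: path_def)
  moreover have "\<forall>xs. path xs \<longrightarrow> length xs < Suc (card (verts G))"
  proof (intro allI impI)
    fix xs assume "path xs"
    then have "card (set xs) = length xs" "set xs \<subseteq> verts G" by (simp_all add: path_def distinct_card)
    then show "length xs < Suc (card (verts G))" using G card_mono[of "verts G" "set xs"]
      by (simp add: simple_graph_def)
  qed
  ultimately have "\<exists>xs. path xs \<and> (\<forall>ys. path ys \<longrightarrow> length ys \<le> length xs)"
    by (rule ex_has_greatest_nat)
  then obtain xs where xs: "path xs" and max: "\<And>ys. path ys \<Longrightarrow> length ys \<le> length xs" by auto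
  have e: "{xs ! 0, xs ! 1} \<in> edges G" using xs by (auto simp: path_def)
  then obtain e' where e': "e' \<in> edges G" "xs ! 0 \<in> e'" "e' \<noteq> {xs ! 0, xs ! 1}"
    using deg[of "{xs ! 0, xs ! 1}" "xs ! 0"] by auto
  then obtain y where y: "y \<noteq> xs ! 0" "e' = {xs ! 0, y}"
    using simple_graphD(3)[OF G, of e' "xs ! 0"] by auto
  have "y \<in> set xs"
  proof (rule ccontr)
    assume "y \<notin> set xs"
    moreover have "{(y # xs) ! k, (y # xs) ! Suc k} \<in> edges G" if "Suc k < length (y # xs)" for k
    proof (cases k)
      case 0
      then show ?thesis using e'(1) y(2) by (simp add: insert_commute)
    next
      case (Suc m)
      then show ?thesis using that xs by (simp add: path_def)
    qed
    moreover have "y \<in> verts G" using simple_graphD(1)[OF G e'(1)] y(2) by simp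
    ultimately have "path (y # xs)" using xs unfolding path_def by simp
    then show False using max[of "y # xs"] by simp
  qed
  then obtain j where j: "j < length xs" "y = xs ! j" by (auto simp: in_set_conv_nth)
  have "j \<noteq> 0" using j y(1) by metis
  moreover have "j \<noteq> 1" using j y(2) e'(3) by metis
  ultimately have j2: "2 \<le> j" by simp
  let ?ys = "take (Suc j) xs"
  let ?E = "{{?ys ! k, ?ys ! (Suc k mod length ?ys)} | k. k < length ?ys}"
  have len: "length ?ys = Suc j" using j by simp
  have "cycle_graph \<lparr>verts = set ?ys, edges = ?E\<rparr>"
    unfolding cycle_graph_def using xs j2 len by (intro exI[of _ ?ys]) (simp add: path_def)
  moreover have "{?ys ! k, ?ys ! (Suc k mod length ?ys)} \<in> edges G" if "k < length ?ys" for k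
  proof (cases "k = j")
    case True
    then show ?thesis using e'(1) y(2) j by (simp add: insert_commute)
  next
    case False
    then show ?thesis using xs that j by (simp add: path_def)
  qed
  moreover have "set ?ys \<subseteq> verts G" using xs set_take_subset[of "Suc j" xs] unfolding path_def by (meson subset_trans)
  ultimately have "\<lparr>verts = set ?ys, edges = ?E\<rparr> \<in> cycles G"
    by (intro cyclesI) (simp_all only: ugraph.select_convs, blast)
  then show ?thesis by blast
qed

lemma finite_cycles:
  assumes "simple_graph G"
  shows "finite (cycles G)"
proof (rule finite_subset)
  show "cycles G \<subseteq> (\<lambda>(V, E). \<lparr>verts = V, edges = E\<rparr>) ` (Pow (verts G) \<times> Pow (edges G))"
  proof
    fix C assume C: "C \<in> cycles G"
    have "C = (\<lambda>(V, E). \<lparr>verts = V, edges = E\<rparr>) (verts C, edges C)" by simp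
    then show "C \<in> (\<lambda>(V, E). \<lparr>verts = V, edges = E\<rparr>) ` (Pow (verts G) \<times> Pow (edges G))"
      by (rule image_eqI) (use cyclesD(2,3)[OF C] in simp)
  qed
  show "finite ((\<lambda>(V, E). \<lparr>verts = V, edges = E\<rparr>) ` (Pow (verts G) \<times> Pow (edges G)))"
    using assms finite_edges[OF assms] by (simp add: simple_graph_def)
qed

lemma sum_degrees:
  assumes G: "simple_graph G"
  shows "(\<Sum>v\<in>verts G. card {e \<in> edges G. v \<in> e}) = 2 * card (edges G)"
proof -
  have fin: "finite (verts G)" "finite (edges G)"
    using G finite_edges[OF G] by (simp_all add: simple_graph_def)
  have "(\<Sum>v\<in>verts G. card {e \<in> edges G. v \<in> e}) = (\<Sum>v\<in>verts G. \<Sum>e\<in>edges G. if v \<in> e then 1 else 0)"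
    using fin by (simp add: sum.If_cases Int_def)
  also have "\<dots> = (\<Sum>e\<in>edges G. \<Sum>v\<in>verts G. if v \<in> e then 1 else 0)" by (rule sum.swap)
  also have "\<dots> = (\<Sum>e\<in>edges G. card e)"
  proof (rule sum.cong[OF refl])
    fix e assume "e \<in> edges G"
    then have "verts G \<inter> e = e" using simple_graphD(1)[OF G] by blast
    then show "(\<Sum>v\<in>verts G. if v \<in> e then 1 else 0) = card e" using fin by (simp add: sum.If_cases)
  qed
  also have "\<dots> = 2 * card (edges G)" using simple_graphD(2)[OF G] by simp
  finally show ?thesis .
qed

section \<open>Deleting a leaf\<close>

context
  fixes G G' :: "'a ugraph" and u w :: 'a
  assumes G: "simple_graph G" and leaf: "{e \<in> edges G. u \<in> e} = {{u, w}}"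
  defines G'_def: "G' \<equiv> \<lparr>verts = verts G - {u}, edges = edges G - {{u, w}}\<rparr>"
begin

lemma leaf_edge_facts: "{u, w} \<in> edges G" "u \<in> verts G" "w \<in> verts G" "w \<noteq> u"
  "e \<in> edges G \<Longrightarrow> u \<in> e \<Longrightarrow> e = {u, w}"
proof -
  show "e \<in> edges G \<Longrightarrow> u \<in> e \<Longrightarrow> e = {u, w}" using leaf by blast
  show e: "{u, w} \<in> edges G" using leaf by blast
  then show "u \<in> verts G" "w \<in> verts G" using simple_graphD(1)[OF G e] by auto
  show "w \<noteq> u" using simple_graphD(2)[OF G e] by auto
qed

lemma simple_delete_leaf: "simple_graph G'"
proof -
  have "\<exists>a\<in>verts G - {u}. \<exists>b\<in>verts G - {u}. a \<noteq> b \<and> e = {a, b}"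
    if "e \<in> edges G - {{u, w}}" for e
  proof -
    have "u \<notin> e" using that leaf_edge_facts(5)[of e] by blast
    then show ?thesis using that G unfolding simple_graph_def by blast
  qed
  then show ?thesis using G by (auto simp: simple_graph_def G'_def)
qed

text \<open>Every vertex of a cycle has two edges of the cycle, so no cycle contains a leaf.\<close>
lemma cycles_delete_leaf: "cycles G' = cycles G"
proof
  show "cycles G' \<subseteq> cycles G" by (auto simp: cycles_def subgraph_def G'_def)
  show "cycles G \<subseteq> cycles G'"
  proof
    fix C assume C: "C \<in> cycles G"
    have u: "u \<notin> verts C"
    proof
      assume "u \<in> verts C"
      then have "card {e \<in> edges C. u \<in> e} = 2" using cycle_vertex_degree[OF cyclesD(1)[OF C]] by simp
      moreover have "{e \<in> edges C. u \<in> e} \<subseteq> {{u, w}}" using cyclesD(3)[OF C] leaf by blast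
      then have "card {e \<in> edges C. u \<in> e} \<le> 1" using card_mono[of "{{u, w}}"] by simp
      ultimately show False by simp
    qed
    moreover have "{u, w} \<notin> edges C" using u simple_graphD(1)[OF cyclesD(4)[OF C]] by blast
    ultimately show "C \<in> cycles G'"
      using cyclesD[OF C] by (intro cyclesI) (auto simp: G'_def)
  qed
qed

text \<open>A walk that visits the leaf $u$ enters and leaves it at $w$. The induction along the walk
  therefore records the position $w$ while the walk is at $u$.\<close>
lemma reachable_delete_leaf:
  assumes "a \<in> verts G'" "b \<in> verts G'"
  shows "reachable G' a b \<longleftrightarrow> reachable G a b"
proof
  show "reachable G' a b \<Longrightarrow> reachable G a b" by (erule reachable_mono) (auto simp: G'_def)
  assume "reachable G a b"
  \<comment> \<open>If the walk currently ends at the leaf, its neighbour is the endpoint in the smaller graph.\<close>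
  then have "reachable G' a (if b = u then w else b)"
  proof (induction rule: reachable_induct)
    case refl
    then show ?case using assms by (auto simp: G'_def)
  next
    case (step x y)
    show ?case
    proof (cases "{x, y} = {u, w}")
      case True
      then have "x = u \<and> y = w \<or> x = w \<and> y = u" by (simp only: doubleton_eq_iff)
      then show ?thesis using step(3) leaf_edge_facts(4) by (elim disjE conjE) simp_all
    next
      case False
      then have "{x, y} \<in> edges G'" using step by (simp add: G'_def)
      moreover have "x \<noteq> u" "y \<noteq> u" using False leaf_edge_facts(5)[OF step(2)] by blast+
      ultimately show ?thesis using step(3) reachable_step[of G' a x y] by simp
    qed
  qed
  then show "reachable G' a b" using assms by (auto simp: G'_def)
qed

text \<open>The leaf imposes the same condition as its neighbour, because the two reach the same
  vertices.\<close>
lemma rooted_TU_delete_leaf: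
  assumes i: "i \<in> verts G'"
  shows "rooted_TU G' i \<longleftrightarrow> rooted_TU G i"
proof -
  have near: "cycles_near G' a = cycles_near G a" if "a \<in> verts G'" for a
  proof -
    have "(\<exists>x\<in>verts C. reachable G' a x) \<longleftrightarrow> (\<exists>x\<in>verts C. reachable G a x)" if "C \<in> cycles G'" for C
      using reachable_delete_leaf[OF \<open>a \<in> verts G'\<close>] cyclesD(2)[OF that] by (meson subsetD)
    then show ?thesis unfolding cycles_near_def cycles_delete_leaf[symmetric] by blast
  qed
  have uw: "reachable G u w" using leaf_edge_facts(1) by (rule reachable_edge)
  have V: "verts G = insert u (verts G')" and w: "w \<in> verts G'"
    using leaf_edge_facts(2-4) by (auto simp: G'_def)
  have "rooted_TU_at G' i a = rooted_TU_at G i a" if "a \<in> verts G'" for a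
    unfolding rooted_TU_at_def near[OF that] reachable_delete_leaf[OF that i] ..
  moreover have "rooted_TU_at G i u = rooted_TU_at G i w"
    unfolding rooted_TU_at_def cycles_near_cong[OF uw] reachable_cong[OF uw] ..
  ultimately show ?thesis using w unfolding rooted_TU_def V by auto
qed

end

section \<open>Deleting a cycle all of whose vertices have degree two\<close>

context
  fixes G G' C :: "'a ugraph"
  assumes G: "simple_graph G" and C: "C \<in> cycles G"
    and deg: "\<And>x. x \<in> verts C \<Longrightarrow> card {e \<in> edges G. x \<in> e} = 2"
  defines G'_def: "G' \<equiv> \<lparr>verts = verts G - verts C, edges = edges G - edges C\<rparr>"
begin

text \<open>A cycle through a vertex of degree two uses both edges there.\<close>
lemma edge_at_cycle_vertex:
  assumes D: "D \<in> cycles G" and x: "x \<in> verts C" "x \<in> verts D" and e: "e \<in> edges G" "x \<in> e"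
  shows "e \<in> edges D"
proof -
  have "{e \<in> edges D. x \<in> e} = {e \<in> edges G. x \<in> e}"
    using cycle_vertex_degree[OF cyclesD(1)[OF D] x(2)] deg[OF x(1)] cyclesD(3)[OF D] finite_edges[OF G]
    by (intro card_subset_eq) auto
  then show ?thesis using e by blast
qed

lemma simple_delete_cycle: "simple_graph G'"
proof -
  have "\<exists>a\<in>verts G - verts C. \<exists>b\<in>verts G - verts C. a \<noteq> b \<and> e = {a, b}"
    if e: "e \<in> edges G - edges C" for e
  proof -
    have "x \<notin> e" if "x \<in> verts C" for x using edge_at_cycle_vertex[OF C that that] e by blast
    moreover obtain a b where "a \<in> verts G" "b \<in> verts G" "a \<noteq> b" "e = {a, b}"
      using e G unfolding simple_graph_def by blast
    ultimately show ?thesis by blast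
  qed
  then show ?thesis using G by (auto simp: simple_graph_def G'_def)
qed

text \<open>The common vertices are closed under following the edges of either cycle, since both
  cycles contain all edges at such a vertex.\<close>
lemma touching_cycle_eq:
  assumes D: "D \<in> cycles G" and x: "x \<in> verts C" "x \<in> verts D"
  shows "D = C"
proof -
  have CV: "b \<in> verts C" if "{a, b} \<in> edges C" for a b
    using simple_graphD(1)[OF cyclesD(4)[OF C] that] by simp
  have DV: "b \<in> verts D" if "{a, b} \<in> edges D" for a b
    using simple_graphD(1)[OF cyclesD(4)[OF D] that] by simp
  have "y \<in> verts C" if "y \<in> verts D" for y
  proof (rule cycle_closed[where P = "\<lambda>y. y \<in> verts C", OF cyclesD(1)[OF D] x(2) x(1) _ that])
    fix a b assume "{a, b} \<in> edges D" "a \<in> verts C"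
    then have "{a, b} \<in> edges C" using cyclesD(3)[OF D] by (intro edge_at_cycle_vertex[OF C, of a]) auto
    then show "b \<in> verts C" by (rule CV)
  qed
  moreover have "y \<in> verts C \<and> y \<in> verts D" if "y \<in> verts C" for y
  proof (rule cycle_closed[where P = "\<lambda>y. y \<in> verts C \<and> y \<in> verts D", OF cyclesD(1)[OF C] x(1) _ _ that])
    fix a b assume ab: "{a, b} \<in> edges C" "a \<in> verts C \<and> a \<in> verts D"
    then have "{a, b} \<in> edges D" using cyclesD(3)[OF C] by (intro edge_at_cycle_vertex[OF D, of a]) auto
    then show "b \<in> verts C \<and> b \<in> verts D" using CV[OF ab(1)] DV by simp
  qed (use x in simp)
  ultimately have V: "verts D = verts C" by blast
  have ne: "e \<noteq> {}" if "e \<in> edges G" for e using simple_graphD(2)[OF G that] by auto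
  have "edges D \<subseteq> edges C"
  proof
    fix e assume e: "e \<in> edges D"
    then obtain y where "y \<in> e" using ne cyclesD(3)[OF D] by blast
    moreover have "y \<in> verts C" using calculation e V simple_graphD(1)[OF cyclesD(4)[OF D]] by blast
    ultimately show "e \<in> edges C" using edge_at_cycle_vertex[OF C] e cyclesD(3)[OF D] by blast
  qed
  moreover have "edges C \<subseteq> edges D"
  proof
    fix e assume e: "e \<in> edges C"
    then obtain y where "y \<in> e" using ne cyclesD(3)[OF C] by blast
    moreover have "y \<in> verts C" using calculation e simple_graphD(1)[OF cyclesD(4)[OF C]] by blast
    ultimately show "e \<in> edges D" using edge_at_cycle_vertex[OF D] V e cyclesD(3)[OF C] by blast
  qed
  ultimately show ?thesis using V by (intro ugraph.equality) auto
qed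

lemma cycles_delete_cycle: "cycles G = insert C (cycles G')" "C \<notin> cycles G'"
proof -
  show "C \<notin> cycles G'"
  proof
    assume "C \<in> cycles G'"
    then have "verts C \<subseteq> verts G - verts C" using cyclesD(2)[of C G'] by (simp add: G'_def)
    then show False using cyclesD(6)[OF C] by blast
  qed
  have "D \<in> cycles G'" if D: "D \<in> cycles G" "D \<noteq> C" for D
  proof -
    have disj: "verts D \<inter> verts C = {}" using touching_cycle_eq[OF D(1)] D(2) by blast
    have "e \<notin> edges C" if e: "e \<in> edges D" for e
    proof
      assume "e \<in> edges C"
      then have "e \<subseteq> verts C" "e \<subseteq> verts D" "card e = 2"
        using simple_graphD(1,2)[OF cyclesD(4)[OF C]] simple_graphD(1)[OF cyclesD(4)[OF D(1)] e] by simp_all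
      moreover have "e = {}" using calculation(1,2) disj by blast
      ultimately show False by simp
    qed
    then show ?thesis
      using cyclesD(1-3)[OF D(1)] disj by (intro cyclesI) (auto simp: G'_def)
  qed
  moreover have "cycles G' \<subseteq> cycles G" by (auto simp: cycles_def subgraph_def G'_def)
  ultimately show "cycles G = insert C (cycles G')" using C by blast
qed

lemma reachable_from_cycle:
  assumes "reachable G a b" "a \<in> verts C"
  shows "b \<in> verts C"
  using assms(1)
proof (induction rule: reachable_induct)
  case (step x y)
  have "{x, y} \<in> edges C" by (rule edge_at_cycle_vertex[OF C step(3,3,2)]) simp
  then show ?case using simple_graphD(1)[OF cyclesD(4)[OF C]] by blast
qed (rule assms(2))

lemma reachable_off_cycle:
  assumes "a \<in> verts G'" "reachable G a b"
  shows "b \<notin> verts C"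
  using reachable_from_cycle[OF reachable_sym[OF assms(2)]] assms(1) by (auto simp: G'_def)

lemma reachable_delete_cycle:
  assumes "a \<in> verts G'"
  shows "reachable G' a b \<longleftrightarrow> reachable G a b"
proof
  show "reachable G' a b \<Longrightarrow> reachable G a b" by (erule reachable_mono) (auto simp: G'_def)
  assume "reachable G a b"
  then show "reachable G' a b"
  proof (induction rule: reachable_induct)
    case (step x y)
    have "{x, y} \<notin> edges C"
      using reachable_off_cycle[OF assms step(1)] simple_graphD(1)[OF cyclesD(4)[OF C], of "{x, y}"] by blast
    then have "{x, y} \<in> edges G'" using step(2) by (simp add: G'_def)
    then show ?case by (rule reachable_step[OF step(3)])
  qed simp
qed

text \<open>The deleted cycle $C$ is a whole component that does not contain $i$, and every other
  component is left unchanged.\<close>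
lemma rooted_TU_delete_cycle:
  assumes i: "i \<in> verts G'"
  shows "rooted_TU G i \<longleftrightarrow> odd (card (edges C)) \<and> rooted_TU G' i"
proof -
  have V: "verts G = verts C \<union> verts G'" using cyclesD(2)[OF C] by (auto simp: G'_def)
  have near: "cycles_near G' a = cycles_near G a" if a: "a \<in> verts G'" for a
    using reachable_delete_cycle[OF a] reachable_off_cycle[OF a] unfolding cycles_near_def cycles_delete_cycle(1) by blast
  have at_C: "rooted_TU_at G i a \<longleftrightarrow> odd (card (edges C))" if a: "a \<in> verts C" for a
  proof -
    have in_C: "x \<in> verts C" if "reachable G a x" for x using that a by (rule reachable_from_cycle)
    have "cycles_near G a = {C}"
    proof (rule equalityI; rule subsetI)
      fix D assume "D \<in> cycles_near G a"
      then obtain x where "D \<in> cycles G" "x \<in> verts D" "reachable G a x"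
        by (auto simp: cycles_near_def)
      then show "D \<in> {C}" using in_C touching_cycle_eq[of D x] by simp
    next
      fix D assume "D \<in> {C}"
      then show "D \<in> cycles_near G a" using C a reachable_refl[of G a] unfolding cycles_near_def by blast
    qed
    moreover have "\<not> reachable G a i" using in_C i by (auto simp: G'_def)
    ultimately show ?thesis unfolding rooted_TU_at_def by simp
  qed
  have "rooted_TU_at G' i a = rooted_TU_at G i a" if "a \<in> verts G'" for a
    unfolding rooted_TU_at_def near[OF that] reachable_delete_cycle[OF that] ..
  then show ?thesis using at_C cyclesD(6)[OF C] unfolding rooted_TU_def V ball_Un by auto
qed


end

section \<open>The weight of an edge set\<close>

text \<open>The exponent is the number of all cycles, because under the condition every component
  without $i$ contains exactly one and the component of $i$ none.\<close>
lemma incidence_weight_eq: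
  assumes "simple_graph G" "i \<in> verts G" "Suc (card (edges G)) = card (verts G)"
  shows "incidence_weight (verts G - {i}) (edges G) = (if rooted_TU G i then 4 ^ card (cycles G) else 0)"
  using assms
proof (induction "card (verts G)" arbitrary: G rule: less_induct)
  case less
  note G = less.prems(1) and i = less.prems(2) and card = less.prems(3)
  have fin: "finite (verts G)" "finite (edges G)"
    using G finite_edges[OF G] by (simp_all add: simple_graph_def)
  let ?deg = "\<lambda>v. card {e \<in> edges G. v \<in> e}"
  consider (isolated) u where "u \<in> verts G" "u \<noteq> i" "?deg u = 0"
    | (leaf) u where "u \<in> verts G" "u \<noteq> i" "?deg u = 1"
    | (big) "\<And>u. u \<in> verts G - {i} \<Longrightarrow> 2 \<le> ?deg u"
  proof (cases "\<forall>u\<in>verts G - {i}. 2 \<le> ?deg u")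
    case True
    then show ?thesis using that(3) by blast
  next
    case False
    then obtain u where "u \<in> verts G" "u \<noteq> i" "?deg u < 2" by (auto simp: not_le)
    then show ?thesis using that(1,2)[of u] less_2_cases[of "?deg u"] by auto
  qed
  then show ?case
  proof cases
    case isolated
    then have iso: "\<And>e. e \<in> edges G \<Longrightarrow> u \<notin> e" using fin by auto
    then have "incidence_weight (verts G - {i}) (edges G) = 0"
      using isolated by (intro incidence_weight_isolated[of u]) auto
    then show ?thesis using isolated_not_rooted_TU[of u G i] isolated iso by simp
  next
    case leaf
    obtain e where e: "{e \<in> edges G. u \<in> e} = {e}"
      using leaf(3) by (auto simp: card_1_singleton_iff)
    then have eG: "e \<in> edges G" "u \<in> e" by auto
    then obtain w where w: "e = {u, w}" using simple_graphD(3)[OF G eG] by auto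
    note leaf_edge = e[unfolded w]
    let ?G' = "\<lparr>verts = verts G - {u}, edges = edges G - {{u, w}}\<rparr>"
    have i': "i \<in> verts ?G'" using i leaf by simp
    have "incidence_weight (({u} \<union> (verts G - {u} - {i}))) ({e} \<union> (edges G - {e}))
        = incidence_weight {u} {e} * incidence_weight (verts G - {u} - {i}) (edges G - {e})"
      using fin e by (intro incidence_weight_Un) auto
    moreover have "{u} \<union> (verts G - {u} - {i}) = verts G - {i}" using leaf by auto
    moreover have "{e} \<union> (edges G - {e}) = edges G" using eG by auto
    ultimately have "incidence_weight (verts G - {i}) (edges G)
        = incidence_weight (verts ?G' - {i}) (edges ?G')"
      using incidence_weight_singleton[OF eG(2)] w by simp
    also have "\<dots> = (if rooted_TU ?G' i then 4 ^ card (cycles ?G') else 0)"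
    proof (rule less.hyps)
      show "card (verts ?G') < card (verts G)" 
        using card_Diff1_less[OF fin(1) leaf(1)] by (simp only: ugraph.select_convs)
      show "Suc (card (edges ?G')) = card (verts ?G')"
        using card card.remove[OF fin(1) leaf(1)] card.remove[OF fin(2) eG(1)]
        unfolding ugraph.select_convs w by linarith
    qed (use simple_delete_leaf[OF G leaf_edge] i' in auto)
    finally show ?thesis
      using rooted_TU_delete_leaf[OF G leaf_edge i'] cycles_delete_leaf[OF G leaf_edge] by simp
  next
    case big
    \<comment> \<open>The degrees sum to twice the number of edges, which is exactly two for every vertex other than the root.\<close>
    have "?deg i + (\<Sum>v\<in>verts G - {i}. ?deg v) = 2 * card (verts G - {i})"
      using sum_degrees[OF G] card i fin sum.remove[OF fin(1) i, of ?deg] by simp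
    moreover have "2 * card (verts G - {i}) \<le> (\<Sum>v\<in>verts G - {i}. ?deg v)"
      using sum_mono[of "verts G - {i}" "\<lambda>_. 2" ?deg] big by simp
    ultimately have degi: "?deg i = 0" and sum: "(\<Sum>v\<in>verts G - {i}. ?deg v) = (\<Sum>v\<in>verts G - {i}. 2)"
      by auto
    have deg2: "?deg v = 2" if "v \<in> verts G - {i}" for v
    proof -
      have "\<forall>v\<in>verts G - {i}. 2 = ?deg v"
        using sum_mono_inv[OF sum[symmetric]] big fin by blast
      then show ?thesis using that by simp
    qed
    have noti: "i \<notin> e" if "e \<in> edges G" for e using degi that fin by auto
    show ?thesis
    proof (cases "edges G = {}")
      case True
      then have "card (verts G) = 1" using card by simp
      then obtain x where "verts G = {x}" by (rule card_1_singletonE)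
      then have V: "verts G = {i}" using i by simp
      have "C \<notin> cycles G" for C
      proof
        assume C: "C \<in> cycles G"
        then obtain x where "x \<in> verts C" using cyclesD(6) by blast
        from cycle_vertex_degree[OF cyclesD(1)[OF C] this] show False
          using cyclesD(3)[OF C] True by simp
      qed
      then have "cycles G = {}" by auto
      then show ?thesis
        using True V by (simp add: incidence_weight_empty rooted_TU_def rooted_TU_at_def cycles_near_def)
    next
      case False
      have "\<exists>e'\<in>edges G. x \<in> e' \<and> e' \<noteq> e" if "e \<in> edges G" "x \<in> e" for x e
      proof (rule ccontr)
        assume "\<not> ?thesis"
        then have "{e \<in> edges G. x \<in> e} = {e}" using that by blast
        then have "?deg x = 1" by simp
        moreover have "?deg x = 2"
          using that(2) noti[OF that(1)] simple_graphD(1)[OF G that(1)] by (intro deg2) blast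
        ultimately show False by simp
      qed
      then obtain C where C: "C \<in> cycles G" using cycle_exists[OF G False] by (metis ex_in_conv)
      note cyc = cyclesD[OF C]
      have iC: "i \<notin> verts C"
      proof
        assume "i \<in> verts C"
        then have "card {e \<in> edges C. i \<in> e} = 2" by (rule cycle_vertex_degree[OF cyc(1)])
        moreover have "{e \<in> edges C. i \<in> e} = {}" using noti cyc(3) by blast
        ultimately show False by simp
      qed
      then have degC: "?deg x = 2" if "x \<in> verts C" for x using that cyc(2) by (intro deg2) auto
      let ?G' = "\<lparr>verts = verts G - verts C, edges = edges G - edges C\<rparr>"
      have i': "i \<in> verts ?G'" using i iC by simp
      have simple': "simple_graph ?G'" by (rule simple_delete_cycle[OF G C degC])
      have finC: "finite (edges C)" using finite_edges[OF cyc(4)] .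
      have "incidence_weight (verts C \<union> (verts G - verts C - {i})) (edges C \<union> (edges G - edges C))
        = incidence_weight (verts C) (edges C) * incidence_weight (verts G - verts C - {i}) (edges G - edges C)"
        using fin cyc finC card_edges_cycle[OF cyc(1)] simple_graphD(1)[OF simple']
        by (intro incidence_weight_Un) auto
      moreover have "verts C \<union> (verts G - verts C - {i}) = verts G - {i}" using cyc(2) iC by auto
      moreover have "edges C \<union> (edges G - edges C) = edges G" using cyc(3) by auto
      ultimately have "incidence_weight (verts G - {i}) (edges G)
        = (if odd (card (edges C)) then 4 else 0) * incidence_weight (verts ?G' - {i}) (edges ?G')"
        using incidence_weight_cycle[OF cyc(1)] card_edges_cycle[OF cyc(1)] by simp
      also have "incidence_weight (verts ?G' - {i}) (edges ?G')
        = (if rooted_TU ?G' i then 4 ^ card (cycles ?G') else 0)"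
      proof (rule less.hyps)
        have "card (verts ?G') = card (verts G) - card (verts C)"
          "card (edges ?G') = card (edges G) - card (verts C)"
          using cyc fin finC card_edges_cycle[OF cyc(1)] by (auto simp: card_Diff_subset)
        moreover have "card (verts C) > 0" "card (verts C) \<le> card (edges G)"
          using cyc fin card_edges_cycle[OF cyc(1)] card_mono[OF fin(2) cyc(3)]
          by (auto simp: card_gt_0_iff)
        ultimately show "card (verts ?G') < card (verts G)" "Suc (card (edges ?G')) = card (verts ?G')"
          using card by auto
      qed (use simple' i' in auto)
      also have "(if odd (card (edges C)) then 4 else 0)
          * (if rooted_TU ?G' i then 4 ^ card (cycles ?G') else 0 :: int)
        = (if rooted_TU G i then 4 ^ card (cycles G) else 0)"
      proof -
        have "card (cycles G) = Suc (card (cycles ?G'))"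
          using cycles_delete_cycle[OF G C degC] finite_cycles[OF simple'] by simp
        then show ?thesis using rooted_TU_delete_cycle[OF G C degC i'] by simp
      qed
      finally show ?thesis .
    qed
  qed
qed

section \<open>Components and their cycles\<close>

lemma component_cong:
  assumes "u \<in> verts H" "v \<in> verts H"
  shows "induced_subgraph H {w \<in> verts H. reachable H u w} = induced_subgraph H {w \<in> verts H. reachable H v w}
    \<longleftrightarrow> reachable H u v"
proof
  assume "induced_subgraph H {w \<in> verts H. reachable H u w} = induced_subgraph H {w \<in> verts H. reachable H v w}"
  then have "{w \<in> verts H. reachable H u w} = {w \<in> verts H. reachable H v w}"
    by (simp add: induced_subgraph_def)
  then show "reachable H u v" using assms(2) reachable_refl[of H v] by blast
next
  assume "reachable H u v"
  then show "induced_subgraph H {w \<in> verts H. reachable H u w} = induced_subgraph H {w \<in> verts H. reachable H v w}"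
    using reachable_cong[of H u v] by simp
qed

context
  fixes H :: "'a ugraph" and K :: "'a \<Rightarrow> 'a ugraph"
  assumes H: "simple_graph H"
  defines K_def: "K \<equiv> \<lambda>u. induced_subgraph H {v \<in> verts H. reachable H u v}"
begin

lemma component_simps: "verts (K u) = {v \<in> verts H. reachable H u v}"
  "edges (K u) = {e \<in> edges H. e \<subseteq> {v \<in> verts H. reachable H u v}}"
  by (simp_all add: K_def induced_subgraph_def)

lemma components_eq: "components H = K ` verts H"
  by (simp add: components_def K_def)

lemma component_eq_iff: "u \<in> verts H \<Longrightarrow> v \<in> verts H \<Longrightarrow> K u = K v \<longleftrightarrow> reachable H u v"
  unfolding K_def by (rule component_cong)

lemma component_connected:
  assumes u: "u \<in> verts H"
  shows "connected_graph (K u)"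
proof -
  have from_u: "reachable (K u) u v" if "reachable H u v" for v
    using that
  proof (induction rule: reachable_induct)
    case (step x y)
    have "reachable H u y" using step(1,2) by (rule reachable_step)
    then have "{x, y} \<in> edges (K u)"
      using step(1,2) simple_graphD(1)[OF H step(2)] by (simp add: component_simps)
    then show ?case by (rule reachable_step[OF step(3)])
  qed simp
  show ?thesis
    unfolding connected_graph_def
  proof (intro conjI ballI)
    have "u \<in> verts (K u)" using u by (simp add: component_simps)
    then show "verts (K u) \<noteq> {}" by blast
    fix v w assume "v \<in> verts (K u)" "w \<in> verts (K u)"
    then have "reachable (K u) u v" "reachable (K u) u w"
      by (simp_all add: component_simps from_u)
    then show "reachable (K u) v w" using reachable_trans[OF reachable_sym] by metis
  qed
qed

text \<open>A cycle is connected, so it lies entirely in the component of each of its vertices.\<close>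
lemma component_cycles: "cycles (K u) = cycles_near H u"
proof (rule equalityI; rule subsetI)
  fix C assume C: "C \<in> cycles (K u)"
  note c = cyclesD[OF C]
  obtain x where "x \<in> verts C" using c(6) by blast
  then have "\<exists>x\<in>verts C. reachable H u x" using c(2) by (auto simp: component_simps)
  moreover have "C \<in> cycles H" using c(1-3) by (intro cyclesI) (auto simp: component_simps)
  ultimately show "C \<in> cycles_near H u" by (simp add: cycles_near_def)
next
  fix C assume "C \<in> cycles_near H u"
  then obtain x where C: "C \<in> cycles H" and x: "x \<in> verts C" "reachable H u x"
    by (auto simp: cycles_near_def)
  note c = cyclesD[OF C]
  have sub: "verts C \<subseteq> {v \<in> verts H. reachable H u v}"
    using c(2) reachable_trans[OF x(2) cycle_reachable[OF C x(1)]] by blast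
  have "edges C \<subseteq> edges (K u)"
    using c(3) simple_graphD(1)[OF c(4)] sub unfolding component_simps by blast
  then show "C \<in> cycles (K u)" using c(1) sub by (intro cyclesI) (simp_all add: component_simps)
qed

lemma tree_component: "u \<in> verts H \<Longrightarrow> tree (K u) \<longleftrightarrow> cycles_near H u = {}"
  by (simp add: tree_def component_connected component_cycles)

lemma odd_unicyclic_component:
  "u \<in> verts H \<Longrightarrow> odd_unicyclic (K u) \<longleftrightarrow> (\<exists>C. cycles_near H u = {C} \<and> odd (card (edges C)))"
  unfolding odd_unicyclic_def unicyclic_def
  by (simp add: component_connected component_cycles) (auto simp: set_eq_iff)

text \<open>A component that is not a tree is odd-unicyclic, so that the tree component of $i$ being the
  only one means that all vertices not reaching $i$ lie in odd-unicyclic components.\<close>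
lemma rooted_TU_iff:
  assumes i: "i \<in> verts H"
  shows "rooted_TU H i \<longleftrightarrow> TU_graph H \<and> (\<exists>T. {C \<in> components H. tree C} = {T} \<and> i \<in> verts T)"
proof (intro iffI conjI)
  assume R: "rooted_TU H i"
  have near: "cycles_near H u = {} \<longleftrightarrow> reachable H u i" if "u \<in> verts H" for u
    using R that unfolding rooted_TU_def rooted_TU_at_def by (metis insert_not_empty)
  have "tree (K u) \<or> odd_unicyclic (K u)" if "u \<in> verts H" for u
    using R that tree_component[OF that] odd_unicyclic_component[OF that]
    unfolding rooted_TU_def rooted_TU_at_def by metis
  then show "TU_graph H" using H by (simp add: TU_graph_def components_eq)
  have "tree (K u) \<longleftrightarrow> K u = K i" if "u \<in> verts H" for u
    using tree_component[OF that] near[OF that] component_eq_iff[OF that i] by simp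
  then have "{C \<in> components H. tree C} = {K i}" using i unfolding components_eq by blast
  moreover have "i \<in> verts (K i)" using i by (simp add: component_simps)
  ultimately show "\<exists>T. {C \<in> components H. tree C} = {T} \<and> i \<in> verts T" by blast
next
  assume "TU_graph H \<and> (\<exists>T. {C \<in> components H. tree C} = {T} \<and> i \<in> verts T)"
  then obtain T where TU: "TU_graph H" and T: "{C \<in> components H. tree C} = {T}" "i \<in> verts T"
    by blast
  then have "T \<in> components H" by blast
  then obtain t where t: "t \<in> verts H" "T = K t" unfolding components_eq by blast
  then have "T = K i" using T(2) component_eq_iff[OF t(1) i] by (simp add: component_simps)
  then have tree: "tree (K u) \<longleftrightarrow> reachable H u i" if "u \<in> verts H" for u
    using T(1) that component_eq_iff[OF that i] unfolding components_eq by blast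
  have odd: "odd_unicyclic (K u)" if "u \<in> verts H" "\<not> reachable H u i" for u
    using TU that tree[OF that(1)] unfolding TU_graph_def components_eq by blast
  have "rooted_TU_at H i u" if "u \<in> verts H" for u
    unfolding rooted_TU_at_def
    using tree[OF that] odd[OF that] tree_component[OF that] odd_unicyclic_component[OF that] by simp
  then show "rooted_TU H i" by (simp add: rooted_TU_def)
qed

text \<open>Sending a cycle to its component is a bijection onto the odd-unicyclic components.\<close>
lemma num_odd_unicyclic_eq:
  assumes R: "rooted_TU H i"
  shows "num_odd_unicyclic H = card (cycles H)"
proof -
  \<comment> \<open>Any vertex of a cycle determines the component that contains the cycle.\<close>
  define a where "a C = (SOME x. x \<in> verts C)" for C :: "'a ugraph"
  have a: "a C \<in> verts C" "a C \<in> verts H" "C \<in> cycles_near H (a C)" if "C \<in> cycles H" for C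
  proof -
    show 1: "a C \<in> verts C" using cyclesD(6)[OF that] unfolding a_def by (simp add: some_in_eq)
    then show "a C \<in> verts H" using cyclesD(2)[OF that] by blast
    show "C \<in> cycles_near H (a C)" using that 1 reachable_refl[of H "a C"] unfolding cycles_near_def by blast
  qed
  have single: "cycles_near H (a C) = {C} \<and> odd (card (edges C))" if C: "C \<in> cycles H" for C
  proof -
    have "rooted_TU_at H i (a C)" using R a(2)[OF C] by (simp add: rooted_TU_def)
    then obtain D where "cycles_near H (a C) = {D}" "odd (card (edges D))"
      using a(3)[OF C] unfolding rooted_TU_at_def by (auto split: if_splits)
    then show ?thesis using a(3)[OF C] by simp
  qed
  have "bij_betw (\<lambda>C. K (a C)) (cycles H) {C \<in> components H. odd_unicyclic C}"
    unfolding bij_betw_def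
  proof (intro conjI)
    show "inj_on (\<lambda>C. K (a C)) (cycles H)"
    proof (rule inj_onI)
      fix C D assume C: "C \<in> cycles H" and D: "D \<in> cycles H" and "K (a C) = K (a D)"
      then have "reachable H (a C) (a D)" using component_eq_iff[OF a(2)[OF C] a(2)[OF D]] by simp
      then have "cycles_near H (a C) = cycles_near H (a D)" by (rule cycles_near_cong)
      then show "C = D" using single[OF C] single[OF D] by simp
    qed
    show "(\<lambda>C. K (a C)) ` cycles H = {C \<in> components H. odd_unicyclic C}"
    proof (rule equalityI; rule subsetI)
      fix X assume "X \<in> (\<lambda>C. K (a C)) ` cycles H"
      then obtain C where C: "C \<in> cycles H" "X = K (a C)" by blast
      then have "odd_unicyclic X" using odd_unicyclic_component[OF a(2)[OF C(1)]] single[OF C(1)] by simp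
      then show "X \<in> {C \<in> components H. odd_unicyclic C}" using C a(2) by (simp add: components_eq)
    next
      fix X assume "X \<in> {C \<in> components H. odd_unicyclic C}"
      then obtain u where u: "u \<in> verts H" "X = K u" "odd_unicyclic (K u)"
        by (auto simp: components_eq)
      then obtain C where "cycles_near H u = {C}" using odd_unicyclic_component[OF u(1)] by blast
      then obtain x where C: "C \<in> cycles H" and x: "x \<in> verts C" "reachable H u x"
        unfolding cycles_near_def by blast
      have "reachable H u (a C)"
        using reachable_trans[OF x(2) cycle_reachable[OF C x(1) a(1)[OF C]]] .
      then have "X = K (a C)" using u(2) component_eq_iff[OF u(1) a(2)[OF C]] by simp
      then show "X \<in> (\<lambda>C. K (a C)) ` cycles H" using C by blast
    qed
  qed
  then show ?thesis unfolding num_odd_unicyclic_def by (rule bij_betw_same_card[symmetric])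
qed

end

section \<open>The principal minors of the signless Laplacian\<close>

text \<open>A principal minor as a sum over the permutations of the remaining indices, without
  renumbering them. Replacing row $i$ by the unit vector does not change the minor and makes it the
  determinant of an $n \times n$ matrix, to which only permutations fixing $i$ contribute.\<close>
lemma det_mat_delete_diagonal:
  assumes A: "A \<in> carrier_mat n n" and i: "i < n"
  shows "det (mat_delete A i i) =
    (\<Sum>p | p permutes ({0..<n} - {i}). signof p * (\<Prod>u\<in>{0..<n} - {i}. A $$ (u, p u)))"
proof -
  define B where "B = mat n n (\<lambda>(u, v). if u = i then (if v = i then 1 else 0) else A $$ (u, v))"
  have B: "B \<in> carrier_mat n n" by (simp add: B_def)
  have "mat_delete B i i = mat_delete A i i"
    using A by (intro eq_matI) (auto simp: mat_delete_def B_def)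
  then have "det (mat_delete A i i) = cofactor B i i"
    by (simp add: cofactor_def flip: mult_2)
  also have "\<dots> = (\<Sum>j<n. B $$ (i, j) * cofactor B i j)"
  proof -
    have "(\<Sum>j<n. B $$ (i, j) * cofactor B i j) = (\<Sum>j<n. if j = i then cofactor B i j else 0)"
      using i by (intro sum.cong) (auto simp: B_def)
    then show ?thesis using i by simp
  qed
  also have "\<dots> = det B" using laplace_expansion_row[OF B i] by simp
  also have "\<dots> = (\<Sum>p | p permutes {0..<n}. signof p * (\<Prod>u = 0..<n. B $$ (u, p u)))"
    by (rule det_def'[OF B])
  also have "\<dots> = (\<Sum>p | p permutes ({0..<n} - {i}). signof p * (\<Prod>u = 0..<n. B $$ (u, p u)))"
  proof (rule sum.mono_neutral_right)
    show "finite {p. p permutes {0..<n}}" by (simp add: finite_permutations)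
    show "{p. p permutes ({0..<n} - {i})} \<subseteq> {p. p permutes {0..<n}}"
      by (auto intro: permutes_subset)
    show "\<forall>p\<in>{p. p permutes {0..<n}} - {p. p permutes ({0..<n} - {i})}.
      signof p * (\<Prod>u = 0..<n. B $$ (u, p u)) = 0"
    proof
      fix p assume p: "p \<in> {p. p permutes {0..<n}} - {p. p permutes ({0..<n} - {i})}"
      then have pn: "p permutes {0..<n}" by simp
      have "p i \<noteq> i"
      proof
        assume "p i = i"
        then have "p permutes ({0..<n} - {i})" by (intro permutes_superset[OF pn]) auto
        then show False using p by simp
      qed
      moreover have "p i < n" using permutes_in_image[OF pn, of i] i by simp
      ultimately have "B $$ (i, p i) = 0" using i by (simp add: B_def)
      then have "(\<Prod>u = 0..<n. B $$ (u, p u)) = 0" using i by (intro prod_zero) auto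
      then show "signof p * (\<Prod>u = 0..<n. B $$ (u, p u)) = 0" by simp
    qed
  qed
  also have "\<dots> = (\<Sum>p | p permutes ({0..<n} - {i}). signof p * (\<Prod>u\<in>{0..<n} - {i}. A $$ (u, p u)))"
  proof (rule sum.cong[OF refl])
    fix p assume "p \<in> {p. p permutes ({0..<n} - {i})}"
    then have p: "p permutes ({0..<n} - {i})" by simp
    have "p i = i" using p by (simp add: permutes_not_in)
    then have "(\<Prod>u = 0..<n. B $$ (u, p u)) = (\<Prod>u\<in>{0..<n} - {i}. B $$ (u, p u))"
      using i by (subst prod.remove[of _ i]) (auto simp: B_def)
    also have "\<dots> = (\<Prod>u\<in>{0..<n} - {i}. A $$ (u, p u))"
    proof (rule prod.cong[OF refl])
      fix u assume u: "u \<in> {0..<n} - {i}"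
      then have "p u \<in> {0..<n} - {i}" using permutes_in_image[OF p, of u] by simp
      then show "B $$ (u, p u) = A $$ (u, p u)" using u by (simp add: B_def)
    qed
    finally show "signof p * (\<Prod>u = 0..<n. B $$ (u, p u))
      = signof p * (\<Prod>u\<in>{0..<n} - {i}. A $$ (u, p u))" by simp
  qed
  finally show ?thesis .
qed

text \<open>This is $Q = N N^T$, entry by entry.\<close>
lemma signless_laplacian_index:
  assumes G: "simple_graph G" and uv: "u < n" "v < n"
  shows "signless_laplacian n G $$ (u, v) = real (card {e \<in> edges G. u \<in> e \<and> v \<in> e})"
proof (cases "u = v")
  case True
  have "{u, u} \<notin> edges G" using simple_graphD(2)[OF G, of "{u, u}"] by auto
  then show ?thesis using uv True
    by (simp add: signless_laplacian_def degree_matrix_def adjacency_matrix_def vertex_degree_def)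
next
  case False
  have "e = {u, v}" if "e \<in> edges G" "u \<in> e" "v \<in> e" for e
    using simple_graphD(3)[OF G that(1,2)] that(3) False by auto
  then have "e \<in> edges G \<and> u \<in> e \<and> v \<in> e \<longleftrightarrow> e = {u, v} \<and> {u, v} \<in> edges G" for e
    by (metis insertCI)
  then have "{e \<in> edges G. u \<in> e \<and> v \<in> e} = (if {u, v} \<in> edges G then {{u, v}} else {})"
    by simp
  then show ?thesis using uv False
    by (simp add: signless_laplacian_def degree_matrix_def adjacency_matrix_def)
qed

theorem theorem2p9:
  fixes G :: "nat ugraph" and n i :: nat
  assumes "n \<ge> 2"
    and "simple_graph G"
    and "connected_graph G"
    and "verts G = {0..<n}"
    and "i \<in> {0..<n}"
  shows "det (mat_delete (signless_laplacian n G) i i) =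
    (\<Sum>H | TU_subgraph H G \<and> card (edges H) = n - 1 \<and>
         (\<exists>T. {C \<in> components H. tree C} = {T} \<and> i \<in> verts T).
       4 ^ num_odd_unicyclic H)"
proof -
  note G = assms(2) and V = assms(4)
  have i: "i < n" using assms(5) by simp
  let ?Q = "signless_laplacian n G"
  let ?U = "{0..<n} - {i}"
  let ?H = "\<lambda>S. \<lparr>verts = {0..<n}, edges = S\<rparr>"
  let ?\<S> = "{S. S \<subseteq> edges G \<and> card S = card ?U}"
  have finE: "finite (edges G)" using finite_edges[OF G] .
  have cardU: "card ?U = n - 1" using i by simp
  have simpleH: "simple_graph (?H S)" if "S \<subseteq> edges G" for S
    using that G unfolding simple_graph_def V by auto
  have Q: "?Q \<in> carrier_mat n n"
    by (simp add: signless_laplacian_def degree_matrix_def adjacency_matrix_def)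
  have "det (mat_delete ?Q i i) = (\<Sum>p | p permutes ?U. signof p * (\<Prod>u\<in>?U. ?Q $$ (u, p u)))"
    by (rule det_mat_delete_diagonal[OF Q i])
  also have "\<dots> = (\<Sum>p | p permutes ?U.
      real_of_int (sign p * (\<Prod>u\<in>?U. int (card {e \<in> edges G. u \<in> e \<and> p u \<in> e}))))"
  proof (rule sum.cong[OF refl])
    fix p assume "p \<in> {p. p permutes ?U}"
    then have p: "p permutes ?U" by simp
    have "(\<Prod>u\<in>?U. ?Q $$ (u, p u)) = (\<Prod>u\<in>?U. real (card {e \<in> edges G. u \<in> e \<and> p u \<in> e}))"
    proof (rule prod.cong[OF refl])
      fix u assume u: "u \<in> ?U"
      then have "p u \<in> ?U" using permutes_in_image[OF p, of u] by simp
      then show "?Q $$ (u, p u) = real (card {e \<in> edges G. u \<in> e \<and> p u \<in> e})"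
        using u by (intro signless_laplacian_index[OF G]) simp_all
    qed
    then show "signof p * (\<Prod>u\<in>?U. ?Q $$ (u, p u))
      = real_of_int (sign p * (\<Prod>u\<in>?U. int (card {e \<in> edges G. u \<in> e \<and> p u \<in> e})))"
      by simp
  qed
  also have "\<dots> = real_of_int (\<Sum>S\<in>?\<S>. incidence_weight ?U S)"
    unfolding leibniz_sum_eq_sum_incidence_weight[OF _ finE, of ?U, simplified, symmetric] by simp
  also have "(\<Sum>S\<in>?\<S>. incidence_weight ?U S)
    = (\<Sum>S\<in>?\<S>. if rooted_TU (?H S) i then 4 ^ card (cycles (?H S)) else 0)"
  proof (rule sum.cong[OF refl])
    fix S assume S: "S \<in> ?\<S>"
    have "incidence_weight (verts (?H S) - {i}) (edges (?H S))
      = (if rooted_TU (?H S) i then 4 ^ card (cycles (?H S)) else 0)"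
      using S i cardU by (intro incidence_weight_eq simpleH) auto
    then show "incidence_weight ?U S = (if rooted_TU (?H S) i then 4 ^ card (cycles (?H S)) else 0)"
      by simp
  qed
  also have "\<dots> = (\<Sum>S | S \<in> ?\<S> \<and> rooted_TU (?H S) i. 4 ^ card (cycles (?H S)))"
    using finE by (intro sum.inter_filter[symmetric]) simp
  also have "\<dots> = (\<Sum>H | TU_subgraph H G \<and> card (edges H) = n - 1 \<and>
         (\<exists>T. {C \<in> components H. tree C} = {T} \<and> i \<in> verts T). 4 ^ num_odd_unicyclic H)"
  proof (rule sum.reindex_bij_witness[where i = edges and j = ?H])
    fix S assume S: "S \<in> {S. S \<in> ?\<S> \<and> rooted_TU (?H S) i}"
    then have H: "simple_graph (?H S)" using simpleH by simp
    have i': "i \<in> verts (?H S)" using i by simp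
    have R: "rooted_TU (?H S) i" using S by simp
    show "edges (?H S) = S" by simp
    show "?H S \<in> {H. TU_subgraph H G \<and> card (edges H) = n - 1 \<and>
         (\<exists>T. {C \<in> components H. tree C} = {T} \<and> i \<in> verts T)}"
      using S H R rooted_TU_iff[OF H i'] V cardU
      by (simp add: TU_subgraph_def spanning_subgraph_def subgraph_def)
    show "4 ^ num_odd_unicyclic (?H S) = (4 :: int) ^ card (cycles (?H S))"
      using num_odd_unicyclic_eq[OF H R] by simp
  next
    fix H assume "H \<in> {H. TU_subgraph H G \<and> card (edges H) = n - 1 \<and>
         (\<exists>T. {C \<in> components H. tree C} = {T} \<and> i \<in> verts T)}"
    then have H: "simple_graph H" "verts H = {0..<n}" "edges H \<subseteq> edges G" "card (edges H) = n - 1"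
      and TU: "TU_graph H \<and> (\<exists>T. {C \<in> components H. tree C} = {T} \<and> i \<in> verts T)"
      using V by (simp_all add: TU_subgraph_def spanning_subgraph_def subgraph_def)
    show eq: "?H (edges H) = H" using H(2) by (intro ugraph.equality) simp_all
    have "rooted_TU H i" using rooted_TU_iff[OF H(1)] H(2) i TU by simp
    then show "edges H \<in> {S. S \<in> ?\<S> \<and> rooted_TU (?H S) i}"
      using H(3,4) cardU eq by simp
  qed
  finally show ?thesis by simp
qed

end
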